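(* Consider $\dot{\vec{x}}=\vec{f}(\vec{x})+\epsilon\,\vec{g}(\vec{x},t)$ on $\Omega\subset\mathbb{R}^3$, with $0<\epsilon\ll 1$, under the standing assumptions listed in the context, where the fixed point $\vec{a}$ of the unperturbed flow has a two-dimensional stable manifold $\Gamma^s(\vec a)$ parametrized by $\bar{\vec x}^s(p,\alpha)$. Let $P,T\in\mathbb{R}$ be finite. Then for $(p,\alpha,t)\in[P,\infty)\times\mathrm{S}^1\times[T,\infty)$ the normal displacement $$d^{s}(p,\alpha,\epsilon,t)=\frac{\vec{f}(\bar{\vec{x}}^{s}(p,\alpha))\wedge\bar{\vec{x}}^{s}_\alpha(p,\alpha)}{\left|\vec{f}(\bar{\vec{x}}^{s}(p,\alpha))\wedge\bar{\vec{x}}^{s}_\alpha(p,\alpha)\right|}\cdot\left[\vec{x}^{s}(p,\alpha,\epsilon,t)-\bar{\vec{x}}^{s}(p,\alpha)\right]$$ of the perturbed stable manifold can be expanded in $\epsilon$ in the form $$d^{s}(p,\alpha,\epsilon,t)=\epsilon\,\frac{M^s(p,\alpha,t)}{\left|\vec{f}(\bar{\vec{x}}^{s}(p,\alpha))\wedge\bar{\vec{x}}^{s}_\alpha(p,\alpha)\right|}+\mathcal{O}(\epsilon^2),$$ where $M^s$ is the convergent improper integral $$M^{s}(p,\alpha,t)=-\int_p^{\infty}\exp\left[\int_{\tau}^p(\nabla\cdot\vec{f})(\bar{\vec{x}}^{s}(\xi,\alpha))\,\mathrm{d}\xi\right]\left[\vec{f}(\bar{\vec{x}}^{s}(\ta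u,\alpha))\wedge\bar{\vec{x}}^{s}_{\alpha}(\tau,\alpha)\right]\cdot\vec{g}(\bar{\vec{x}}^{s}(\tau,\alpha),\tau+t-p)\,\mathrm{d}\tau.$$
   Context: Here $\wedge$ is the cross product in $\mathbb{R}^3$, a subscript $\alpha$ denotes $\partial/\partial\alpha$, and $\mathrm{S}^1=[0,1)$ extended periodically with period $1$. $\mathcal{O}(\cdot)$ refers to $\epsilon\to0$. Standing assumptions. $\vec f:\Omega\to\mathbb{R}^3$ is $C^2$ with $D\vec f$ bounded on $\Omega$. For each $t\in\mathbb{R}$, $\vec g(\cdot,t)\in C^2(\Omega)$, and $\vec g$, $D\vec g$ (spatial derivative) are bounded on $\Omega\times\mathbb{R}$. $\vec a$ satisfies $\vec f(\vec a)=\vec 0$, and $D\vec f(\vec a)$ has one positive eigenvalue and two eigenvalues with negative real parts; the eigenvectors associated with the two-dimensional stable subspace are linearly independent. The two-dimensional stable manifold $\Gamma^s(\vec a)$ of $\vec a$ for $\dot{\vec x}=\vec f(\vec x)$ is $C^2$-smooth. Parametrization of $\Gamma^s(\vec a)$. The trajectories of $\dot{\vec x}=\vec f(\vec x)$ foliating $\Gamma^s(\vec a)\setminus\{\vec a\}$ are labelled by $\alpha\in\mathrm{S}^1$ (a small circle around $\vec a$ in the tangent plane meets each such trajectory exactly once, and $\alpha$ is the angle divided by $2\pi$), and $p$ is time along the trajectory: $\partial_p\bar{\vec x}^s(p,\alpha)=\vec f(\bar{\vec x}^s(p,\alpha))$, $\lim_{p\to\infty}\bar{\vec x}^s(p,\alpha)=\vec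 a$. The parametrization $(p,\alpha)\in[P,\infty)\times\mathrm{S}^1$ is $C^1$-smooth, and $\vec f(\bar{\vec x}^s)$ and $\bar{\vec x}^s_\alpha$ are linearly independent at every $(p,\alpha)$. Perturbed manifold. For small $\epsilon$, the fixed point $\vec a$ persists as a hyperbolic trajectory $\vec a_\epsilon(t)$ that is $\mathcal{O}(\epsilon)$-close to $\vec a$, with stable manifold $\Gamma^s_\epsilon(\vec a_\epsilon,t)$ (time-slice at $t$) that is $\mathcal{O}(\epsilon)$-close to $\Gamma^s(\vec a)$. The point $\vec x^s(p,\alpha,\epsilon,t)\in\Gamma^s_\epsilon(\vec a_\epsilon,t)$ is a point $\mathcal{O}(\epsilon)$-close to $\bar{\vec x}^s(p,\alpha)$; more precisely, with $t$ and $(p,\alpha)$ fixed, $\tau\mapsto\vec x^s(p,\alpha,\epsilon,\tau)$, $\tau\ge t$, is the solution of the perturbed equation through this point, it lies on the perturbed stable manifold, and it satisfies $|\vec x^s(p,\alpha,\epsilon,\tau)-\bar{\vec x}^s(\tau-t+p,\alpha)|\le K\epsilon$ for all $\tau\in[t,\infty)$, with $K$ independent of $\tau$ and of $\epsilon\in[0,\epsilon_0]$ for some $\epsilon_0>0$. *)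

theory Defs
  imports "HOL-Analysis.Analysis" "HOL-Library.Landau_Symbols"
begin

section \<open>Smoothness\<close>

text \<open>Derivatives are taken within the set, so that domains with boundary such as
  \<open>[P, \<infinity>) \<times> \<real>\<close> are covered; on open sets these are the usual derivatives.\<close>

definition C1_on :: "('a::real_normed_vector \<Rightarrow> 'b::real_normed_vector) \<Rightarrow> 'a set \<Rightarrow> bool" where
  "C1_on h S \<longleftrightarrow> (\<exists>h'. (\<forall>x\<in>S. (h has_derivative blinfun_apply (h' x)) (at x within S)) \<and>
     continuous_on S h')"

definition C2_on :: "('a::real_normed_vector \<Rightarrow> 'b::real_normed_vector) \<Rightarrow> 'a set \<Rightarrow> bool" where
  "C2_on h S \<longleftrightarrow> (\<exists>h'. (\<forall>x\<in>S. (h has_derivative blinfun_apply (h' x)) (at x within S)) \<and>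
     C1_on h' S)"

definition divergence :: "(real^3 \<Rightarrow> real^3) \<Rightarrow> real^3 \<Rightarrow> real" where
  "divergence f x = trace (jacobian f (at x))"


section \<open>Spectral notions for real matrices\<close>

definition eigenpair :: "real^'n^'n \<Rightarrow> complex \<Rightarrow> complex^'n \<Rightarrow> bool" where
  "eigenpair A l v \<longleftrightarrow> v \<noteq> 0 \<and> map_matrix complex_of_real A *v v = l *s v"

text \<open>One positive eigenvalue and, counted with multiplicity, two eigenvalues with negative real
  part; the eigenvalues \<open>l1\<close>, \<open>l2\<close> may coincide, but their eigenvectors are
  linearly independent over the complex numbers.\<close>

definition saddle_2_stable :: "real^3^3 \<Rightarrow> bool" where
  "saddle_2_stable A \<longleftrightarrow> (\<exists>(lu::real) l1 l2 vu v1 v2.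
     0 < lu \<and> Re l1 < 0 \<and> Re l2 < 0 \<and>
     eigenpair A (complex_of_real lu) vu \<and> eigenpair A l1 v1 \<and> eigenpair A l2 v2 \<and>
     v1 \<noteq> v2 \<and> vec.independent {v1, v2})"

text \<open>This is the real stable subspace whenever, as in \<open>saddle_2_stable\<close>, the stable part
  of the matrix is diagonalizable over the complex numbers.\<close>

definition stable_subspace :: "real^'n^'n \<Rightarrow> (real^'n) set" where
  "stable_subspace A = span {w. \<exists>l v. eigenpair A l v \<and> Re l < 0 \<and>
     (w = (\<chi> i. Re (v $ i)) \<or> w = (\<chi> i. Im (v $ i)))}"


section \<open>Trajectories and stable manifolds\<close>

definition solves_on ::
  "(real^3 \<Rightarrow> real \<Rightarrow> real^3) \<Rightarrow> (real^3) set \<Rightarrow> (real \<Rightarrow> real^3) \<Rightarrow> real set \<Rightarrow> bool" where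
  "solves_on F \<Omega> y I \<longleftrightarrow>
     (\<forall>\<tau>\<in>I. y \<tau> \<in> \<Omega> \<and> (y has_vector_derivative F (y \<tau>) \<tau>) (at \<tau> within I))"

text \<open>The time slice at \<open>t\<close> of the stable manifold of the trajectory \<open>b\<close>.\<close>

definition stable_manifold ::
  "(real^3 \<Rightarrow> real \<Rightarrow> real^3) \<Rightarrow> (real^3) set \<Rightarrow> (real \<Rightarrow> real^3) \<Rightarrow> real \<Rightarrow> (real^3) set" where
  "stable_manifold F \<Omega> b t =
     {x. \<exists>y. solves_on F \<Omega> y {t..} \<and> y t = x \<and> ((\<lambda>\<tau>. y \<tau> - b \<tau>) \<longlongrightarrow> 0) at_top}"

text \<open>For an autonomous field the slice does not depend on the time, and time 0 is used.\<close>

definition stable_manifold_fp ::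
  "(real^3 \<Rightarrow> real^3) \<Rightarrow> (real^3) set \<Rightarrow> real^3 \<Rightarrow> (real^3) set" where
  "stable_manifold_fp f \<Omega> a = stable_manifold (\<lambda>x t. f x) \<Omega> (\<lambda>t. a) 0"

text \<open>Exponential dichotomy on the whole line of \<open>y' = A t y\<close>, with fundamental matrix \<open>X\<close>
  and projection \<open>Q\<close>.\<close>

definition exponential_dichotomy :: "(real \<Rightarrow> real^3^3) \<Rightarrow> bool" where
  "exponential_dichotomy A \<longleftrightarrow> (\<exists>(X :: real \<Rightarrow> real^3^3) (Q :: real^3^3) K \<kappa>.
     (\<forall>t. invertible (X t) \<and> (X has_vector_derivative A t ** X t) (at t)) \<and>
     Q ** Q = Q \<and> 0 < \<kappa> \<and>
     (\<forall>s t. s \<le> t \<longrightarrow>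
        norm (X t ** Q ** matrix_inv (X s)) \<le> K * exp (- \<kappa> * (t - s)) \<and>
        norm (X s ** (mat 1 - Q) ** matrix_inv (X t)) \<le> K * exp (- \<kappa> * (t - s))))"

definition hyperbolic_trajectory ::
  "(real^3 \<Rightarrow> real \<Rightarrow> real^3) \<Rightarrow> (real^3) set \<Rightarrow> (real \<Rightarrow> real^3) \<Rightarrow> bool" where
  "hyperbolic_trajectory F \<Omega> b \<longleftrightarrow> solves_on F \<Omega> b UNIV \<and>
     exponential_dichotomy (\<lambda>t. jacobian (\<lambda>x. F x t) (at (b t)))"

text \<open>The two-dimensional stable manifold of \<open>a\<close> is an injectively immersed \<open>C\<^sup>2\<close> surface with
  global chart \<open>\<Phi>\<close> on \<open>V\<close>, tangent at \<open>a\<close> to the stable subspace. It need not be embedded: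
  the manifold may accumulate on itself in the ambient space. A single chart is no restriction,
  since a stable manifold of this dimension is diffeomorphic to the plane.\<close>

definition C2_stable_manifold_chart ::
  "(real^3 \<Rightarrow> real^3) \<Rightarrow> (real^3) set \<Rightarrow> real^3 \<Rightarrow> (real^2 \<Rightarrow> real^3) \<Rightarrow> (real^2) set \<Rightarrow> bool" where
  "C2_stable_manifold_chart f \<Omega> a \<Phi> V \<longleftrightarrow>
     open V \<and> 0 \<in> V \<and> inj_on \<Phi> V \<and> C2_on \<Phi> V \<and>
     (\<forall>v\<in>V. inj (frechet_derivative \<Phi> (at v))) \<and>
     \<Phi> 0 = a \<and> \<Phi> ` V = stable_manifold_fp f \<Omega> a \<and>
     range (frechet_derivative \<Phi> (at 0)) = stable_subspace (jacobian f (at a))"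

text \<open>Since an immersed surface need not carry the subspace topology, continuity and the limit
  \<open>a\<close> (which has coordinates 0) are also required in the coordinates of the surface.
  The last conjunct says that each trajectory of the stable manifold other than \<open>a\<close> carries
  exactly one label in \<open>[0, 1)\<close>; a trajectory is identified by where it eventually runs,
  because only its part with \<open>p \<ge> P\<close> is parametrized.\<close>

definition stable_manifold_parametrization ::
  "(real^3 \<Rightarrow> real^3) \<Rightarrow> (real^3) set \<Rightarrow> real^3 \<Rightarrow> (real^2 \<Rightarrow> real^3) \<Rightarrow> (real^2) set \<Rightarrow> real \<Rightarrow>
   (real \<Rightarrow> real \<Rightarrow> real^3) \<Rightarrow> bool" where
  "stable_manifold_parametrization f \<Omega> a \<Phi> V P xbar \<longleftrightarrow>
     (\<forall>p\<ge>P. \<forall>\<alpha>. xbar p (\<alpha> + 1) = xbar p \<alpha>) \<and>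
     (\<forall>\<alpha>. solves_on (\<lambda>x t. f x) \<Omega> (\<lambda>p. xbar p \<alpha>) {P..}) \<and>
     (\<forall>\<alpha>. ((\<lambda>p. xbar p \<alpha>) \<longlongrightarrow> a) at_top) \<and>
     C1_on (\<lambda>(p, \<alpha>). xbar p \<alpha>) ({P..} \<times> UNIV) \<and>
     continuous_on ({P..} \<times> UNIV) (\<lambda>(p, \<alpha>). the_inv_into V \<Phi> (xbar p \<alpha>)) \<and>
     (\<forall>\<alpha>. ((\<lambda>p. the_inv_into V \<Phi> (xbar p \<alpha>)) \<longlongrightarrow> 0) at_top) \<and>
     (\<forall>p\<ge>P. \<forall>\<alpha>. xbar p \<alpha> \<noteq> a) \<and>
     (\<forall>x\<in>stable_manifold_fp f \<Omega> a - {a}. \<exists>!\<alpha>. \<alpha> \<in> {0..<1} \<and>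
        (\<exists>y s p. solves_on (\<lambda>x t. f x) \<Omega> y {0..} \<and> y 0 = x \<and>
           0 \<le> s \<and> P \<le> p \<and> y s = xbar p \<alpha>))"


section \<open>Normal displacement and Melnikov function\<close>

definition xbar_alpha :: "(real \<Rightarrow> real \<Rightarrow> real^3) \<Rightarrow> real \<Rightarrow> real \<Rightarrow> real^3" where
  "xbar_alpha xbar p \<alpha> = vector_derivative (\<lambda>\<beta>. xbar p \<beta>) (at \<alpha>)"

definition normal_vec ::
  "(real^3 \<Rightarrow> real^3) \<Rightarrow> (real \<Rightarrow> real \<Rightarrow> real^3) \<Rightarrow> real \<Rightarrow> real \<Rightarrow> real^3" where
  "normal_vec f xbar p \<alpha> = cross3 (f (xbar p \<alpha>)) (xbar_alpha xbar p \<alpha>)"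

definition normal_displacement ::
  "(real^3 \<Rightarrow> real^3) \<Rightarrow> (real \<Rightarrow> real \<Rightarrow> real^3) \<Rightarrow> (real \<Rightarrow> real \<Rightarrow> real \<Rightarrow> real \<Rightarrow> real^3) \<Rightarrow>
   real \<Rightarrow> real \<Rightarrow> real \<Rightarrow> real \<Rightarrow> real" where
  "normal_displacement f xbar xs p \<alpha> \<epsilon> t =
     (normal_vec f xbar p \<alpha> /\<^sub>R norm (normal_vec f xbar p \<alpha>)) \<bullet> (xs p \<alpha> \<epsilon> t - xbar p \<alpha>)"

text \<open>Only \<open>\<tau> \<ge> p\<close> occurs, so the oriented integral of the divergence from \<open>\<tau>\<close> to \<open>p\<close> is minus
  the integral over \<open>{p..\<tau>}\<close>.\<close>

definition melnikov_integrand ::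
  "(real^3 \<Rightarrow> real^3) \<Rightarrow> (real^3 \<Rightarrow> real \<Rightarrow> real^3) \<Rightarrow> (real \<Rightarrow> real \<Rightarrow> real^3) \<Rightarrow>
   real \<Rightarrow> real \<Rightarrow> real \<Rightarrow> real \<Rightarrow> real" where
  "melnikov_integrand f g xbar p \<alpha> t \<tau> =
     exp (- integral {p..\<tau>} (\<lambda>\<xi>. divergence f (xbar \<xi> \<alpha>))) *
     (normal_vec f xbar \<tau> \<alpha> \<bullet> g (xbar \<tau> \<alpha>) (\<tau> + t - p))"

text \<open>The Henstock--Kurzweil integral over \<open>{p..}\<close> exists exactly when the improper integral
  converges, and then has the same value.\<close>

definition melnikov ::
  "(real^3 \<Rightarrow> real^3) \<Rightarrow> (real^3 \<Rightarrow> real \<Rightarrow> real^3) \<Rightarrow> (real \<Rightarrow> real \<Rightarrow> real^3) \<Rightarrow>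
   real \<Rightarrow> real \<Rightarrow> real \<Rightarrow> real" where
  "melnikov f g xbar p \<alpha> t = - integral {p..} (melnikov_integrand f g xbar p \<alpha> t)"

end

theory Submission
  imports Defs
begin

text \<open>Fix a trajectory \<open>x\<close> of the stable manifold, let \<open>A\<close> be \<open>Df\<close> along \<open>x\<close>, and let \<open>w\<close> be the
  normal \<open>f \<times> x\<^sub>\<alpha>\<close> multiplied by \<open>exp (- \<integral> div f)\<close>. Both \<open>f\<close> and \<open>x\<^sub>\<alpha>\<close> solve the variational equation,
  hence \<open>w\<close> solves the adjoint equation \<open>w' = - A\<^sup>T w\<close>. As the tangent plane converges to the
  stable subspace, \<open>w\<close> aligns with the left unstable eigenvector and decays exponentially.
  For \<open>u = x\<^sub>\<epsilon> - x\<close> one has \<open>u' = A u + \<epsilon> g + O(\<epsilon>\<^sup>2)\<close>, so \<open>(w \<bullet> u)' = \<epsilon> w \<bullet> g + |w| O(\<epsilon>\<^sup>2)\<close>; integrating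
  to infinity gives the expansion.\<close>

lemma saddle_left_eigenvector:
  fixes A :: "real^3^3"
  assumes "saddle_2_stable A"
  obtains \<mu> where "\<mu> > 0"
    "\<And>n x. (\<And>z. z \<in> stable_subspace A \<Longrightarrow> n \<bullet> z = 0) \<Longrightarrow> n \<bullet> (A *v x) = \<mu> * (n \<bullet> x)"
proof -
  from assms obtain lu :: real and l1 l2 vu v1 v2 where lu: "0 < lu"
    and l1: "Re l1 < 0" and l2: "Re l2 < 0"
    and eu: "eigenpair A (complex_of_real lu) vu" and e1: "eigenpair A l1 v1" and e2: "eigenpair A l2 v2"
    and ne: "v1 \<noteq> v2" and ind: "vec.independent {v1, v2}"
    unfolding saddle_2_stable_def by blast
  let ?M = "map_matrix complex_of_real A"
  have Mu: "?M *v vu = complex_of_real lu *s vu" "vu \<noteq> 0"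
    and M1: "?M *v v1 = l1 *s v1" and M2: "?M *v v2 = l2 *s v2"
    using eu e1 e2 by (auto simp: eigenpair_def)
  have l_ne: "complex_of_real lu - l1 \<noteq> 0" "complex_of_real lu - l2 \<noteq> 0"
    using lu l1 l2 by (auto simp: complex_eq_iff)
  have "vu \<notin> vec.span {v1, v2}"
  proof
    assume "vu \<in> vec.span {v1, v2}"
    then obtain a b where "vu - a *s v1 - b *s v2 = 0"
      by (auto simp: vec.span_insert)
    then have vu: "vu = a *s v1 + b *s v2"
      by (metis diff_diff_eq right_minus_eq)
    have "?M *v vu = (a * l1) *s v1 + (b * l2) *s v2"
      unfolding vu matrix_vector_right_distrib vector_scalar_commute M1 M2
      by (simp add: vector_smult_assoc)
    then have "(a * (complex_of_real lu - l1)) *s v1 + (b * (complex_of_real lu - l2)) *s v2 = 0"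
      unfolding Mu by (simp add: vu vec_eq_iff algebra_simps)
    then have "(\<Sum>v\<in>{v1, v2}. (if v = v1 then a * (complex_of_real lu - l1) else b * (complex_of_real lu - l2)) *s v) = 0"
      using ne by simp
    from vec.independentD[OF ind _ _ this, of v1] vec.independentD[OF ind _ _ this, of v2]
    have "a * (complex_of_real lu - l1) = 0 \<and> b * (complex_of_real lu - l2) = 0"
      using ne by simp
    then show False
      using l_ne vu Mu(2) by simp
  qed
  then have "vec.independent {vu, v1, v2}"
    using ind by (simp add: vec.independent_insertI)
  moreover have "card {vu, v1, v2} = 3"
    using \<open>vu \<notin> vec.span {v1, v2}\<close> ne by (auto simp: vec.span_base card_insert_if)
  ultimately have span: "vec.span {vu, v1, v2} = UNIV"
    using vec.card_ge_dim_independent[of "{vu, v1, v2}" UNIV] vec_dim_card[where 'n=3 and 'a=complex]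
    by auto
  show thesis
  proof
    show "0 < lu" by fact
    fix n x :: "real^3"
    assume n: "\<And>z. z \<in> stable_subspace A \<Longrightarrow> n \<bullet> z = 0"
    define b :: "complex^3 \<Rightarrow> complex" where "b z = (\<Sum>i\<in>UNIV. of_real (n $ i) * z $ i)" for z
    have b_0: "b 0 = 0" by (simp add: b_def)
    have b_add: "b (y + z) = b y + b z" and b_scale: "b (c *s z) = c * b z" for y z c
      by (simp_all add: b_def sum.distrib algebra_simps sum_distrib_left)
    have b_stable: "b v = 0" if "eigenpair A l v" "Re l < 0" for l v
    proof -
      have "(\<chi> i. Re (v $ i)) \<in> stable_subspace A" "(\<chi> i. Im (v $ i)) \<in> stable_subspace A"
        unfolding stable_subspace_def using that by (blast intro: span_base)+
      from this[THEN n] show ?thesis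
        by (simp add: b_def complex_eq_iff inner_vec_def)
    qed
    have "vec.span {vu, v1, v2} \<subseteq> {z. b (?M *v z) = lu * b z}"
    proof (rule vec.span_minimal)
      show "{vu, v1, v2} \<subseteq> {z. b (?M *v z) = lu * b z}"
        using b_stable[OF e1 l1] b_stable[OF e2 l2] by (simp add: Mu M1 M2 b_scale)
      show "vec.subspace {z. b (?M *v z) = lu * b z}"
        by (simp add: vec.subspace_def b_0 b_add b_scale matrix_vector_right_distrib vector_scalar_commute
            distrib_left mult.left_commute)
    qed
    then have "b (?M *v (\<chi> i. of_real (x $ i))) = lu * b (\<chi> i. of_real (x $ i))"
      by (rule CollectD[OF subsetD]) (simp add: span)
    also have "?M *v (\<chi> i. of_real (x $ i)) = (\<chi> i. of_real ((A *v x) $ i))"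
      by (simp add: map_matrix_def matrix_vector_mult_def vec_eq_iff)
    finally have "complex_of_real (n \<bullet> (A *v x)) = complex_of_real (lu * (n \<bullet> x))"
      by (simp add: b_def inner_vec_def)
    then show "n \<bullet> (A *v x) = lu * (n \<bullet> x)"
      by (simp only: of_real_eq_iff)
  qed
qed

lemma cross3_trace:
  fixes A :: "real^3^3"
  shows "cross3 (A *v u) v + cross3 u (A *v v) = trace A *\<^sub>R cross3 u v - transpose A *v cross3 u v"
  by (simp add: cross3_simps trace_def transpose_def matrix_vector_mult_def forall_3)

lemma cross3_parallel:
  fixes n u v :: "real^3"
  assumes "n \<noteq> 0" "n \<bullet> u = 0" "n \<bullet> v = 0"
  obtains c where "cross3 u v = c *\<^sub>R n"
proof -
  have "cross3 n (cross3 u v) = 0"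
    using assms(2,3) by (simp add: Lagrange)
  then show thesis
    using that assms(1) by (metis cross_eq_0 collinear_lemma scaleR_zero_left)
qed

lemma bounded_bilinear_cross3: "bounded_bilinear cross3"
  using bilinear_conv_bounded_bilinear bilinear_cross by blast

lemma has_vector_derivative_cross3:
  assumes "(u has_vector_derivative u') (at s within S)" "(v has_vector_derivative v') (at s within S)"
  shows "((\<lambda>s. cross3 (u s) (v s)) has_vector_derivative (cross3 (u s) v' + cross3 u' (v s))) (at s within S)"
  by (rule bounded_bilinear.has_vector_derivative[OF bounded_bilinear_cross3 assms])

lemma norm_matrix_vector_mult_le:
  fixes A :: "real^'n^'m"
  shows "norm (A *v x) \<le> CARD('m) * norm A * norm x"
proof -
  have "norm (A *v x) \<le> (\<Sum>i\<in>UNIV. \<bar>(A *v x) $ i\<bar>)"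
    by (rule norm_le_l1_cart)
  also have "\<dots> \<le> (\<Sum>i\<in>(UNIV::'m set). norm A * norm x)"
  proof (rule sum_mono)
    fix i
    have "\<bar>(A *v x) $ i\<bar> \<le> norm (A $ i) * norm x"
      by (simp add: matrix_mult_dot Cauchy_Schwarz_ineq2)
    also have "\<dots> \<le> norm A * norm x"
      by (simp add: mult_right_mono component_le_norm_cart Finite_Cartesian_Product.norm_nth_le)
    finally show "\<bar>(A *v x) $ i\<bar> \<le> norm A * norm x" .
  qed
  finally show ?thesis by simp
qed

lemma derivative_normal_to_range:
  fixes \<Phi> :: "'a::euclidean_space \<Rightarrow> 'b::euclidean_space" and \<gamma> :: "real \<Rightarrow> 'a"
  assumes \<Phi>: "(\<Phi> has_derivative L) (at (\<gamma> s))" and "inj L"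
    and \<gamma>: "continuous (at s within I) \<gamma>"
    and x: "((\<Phi> \<circ> \<gamma>) has_vector_derivative x') (at s within I)"
    and n: "\<And>h. n \<bullet> L h = 0" and nontriv: "at s within I \<noteq> bot"
  shows "n \<bullet> x' = 0"
proof -
  let ?v0 = "\<gamma> s"
  have linL: "bounded_linear L" using \<Phi> by (rule has_derivative_bounded_linear)
  obtain c where c: "c > 0" "\<And>h. c * norm h \<le> norm (L h)"
    using linear_inj_bounded_below_pos[OF bounded_linear.linear[OF linL] \<open>inj L\<close>] by blast
  define q where "q h = (\<Phi> (\<gamma> h) - \<Phi> ?v0) /\<^sub>R (h - s)" for h
  have "((\<lambda>h. norm (q h - x')) \<longlongrightarrow> 0) (at s within I) \<longleftrightarrow>
      ((\<lambda>h. norm (\<Phi> (\<gamma> h) - \<Phi> ?v0 - (h - s) *\<^sub>R x') / norm (h - s)) \<longlongrightarrow> 0) (at s within I)"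
  proof (rule Lim_cong_within)
    fix h assume "h \<noteq> s"
    then have "q h - x' = (\<Phi> (\<gamma> h) - \<Phi> ?v0 - (h - s) *\<^sub>R x') /\<^sub>R (h - s)"
      by (simp add: q_def scaleR_diff_right)
    then show "norm (q h - x') = norm (\<Phi> (\<gamma> h) - \<Phi> ?v0 - (h - s) *\<^sub>R x') / norm (h - s)"
      by (simp add: divide_inverse abs_inverse mult.commute)
  qed auto
  then have q: "(q \<longlongrightarrow> x') (at s within I)"
    using x by (simp add: has_vector_derivative_def has_derivative_iff_norm tendsto_norm_zero_iff Lim_null[of q])
  have bound: "\<bar>n \<bullet> x'\<bar> \<le> e * norm x'" if e: "e > 0" for e
  proof -
    define d where "d = min (c / 2) (e * c / (2 * (norm n + 1)))"
    have d: "d > 0" "d \<le> c / 2" "d \<le> e * c / (2 * (norm n + 1))"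
      unfolding d_def using e c(1) by (intro min.cobounded1 min.cobounded2
          iffD2[OF min_less_iff_conj] conjI divide_pos_pos mult_pos_pos add_nonneg_pos norm_ge_zero; simp)+
    have "\<forall>\<^sub>F v in nhds ?v0. norm (\<Phi> v - \<Phi> ?v0 - L (v - ?v0)) \<le> d * norm (v - ?v0)"
      using \<Phi> d(1) unfolding has_derivative_at_alt eventually_nhds_metric dist_norm by blast
    then have "\<forall>\<^sub>F h in at s within I. norm (\<Phi> (\<gamma> h) - \<Phi> ?v0 - L (\<gamma> h - ?v0)) \<le> d * norm (\<gamma> h - ?v0)"
      using \<gamma> unfolding continuous_within by (rule eventually_compose_filterlim)
    then have "\<forall>\<^sub>F h in at s within I. \<bar>n \<bullet> q h\<bar> \<le> e * norm (q h)"
    proof (rule eventually_mono)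
      fix h assume h: "norm (\<Phi> (\<gamma> h) - \<Phi> ?v0 - L (\<gamma> h - ?v0)) \<le> d * norm (\<gamma> h - ?v0)"
      let ?D = "\<Phi> (\<gamma> h) - \<Phi> ?v0" and ?w = "\<gamma> h - ?v0"
      have "c * norm ?w \<le> norm (L ?w)" by (rule c)
      also have "\<dots> \<le> norm ?D + d * norm ?w"
        using h norm_triangle_ineq2[of "L ?w" ?D] by (simp add: norm_minus_commute)
      also have "\<dots> \<le> norm ?D + c / 2 * norm ?w"
        using mult_right_mono[OF d(2), of "norm ?w"] by simp
      finally have w: "norm ?w \<le> 2 / c * norm ?D" using c(1) by (simp add: field_simps)
      have "\<bar>n \<bullet> ?D\<bar> = \<bar>n \<bullet> (?D - L ?w)\<bar>" by (simp add: inner_diff_right n)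
      also have "\<dots> \<le> norm n * norm (?D - L ?w)" by (rule Cauchy_Schwarz_ineq2)
      also have "\<dots> \<le> (norm n + 1) * (d * (2 / c * norm ?D))"
        using order_trans[OF h mult_left_mono[OF w, of d]] d(1) by (intro mult_mono) auto
      also have "\<dots> = (norm n + 1) * d * (2 / c) * norm ?D" by simp
      also have "\<dots> \<le> e * norm ?D"
      proof (rule mult_right_mono)
        have "0 < norm n + 1" using norm_ge_zero[of n] by linarith
        then show "(norm n + 1) * d * (2 / c) \<le> e"
          using d(3) c(1) by (simp add: field_simps)
      qed simp
      finally have "\<bar>n \<bullet> ?D\<bar> \<le> e * norm ?D" .
      then have "\<bar>inverse (h - s)\<bar> * \<bar>n \<bullet> ?D\<bar> \<le> \<bar>inverse (h - s)\<bar> * (e * norm ?D)"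
        by (rule mult_left_mono) simp
      then show "\<bar>n \<bullet> q h\<bar> \<le> e * norm (q h)"
        by (simp add: q_def abs_mult mult_ac)
    qed
    then show ?thesis
      by (rule tendsto_le[OF nontriv _ _, rotated 2]) (intro tendsto_intros q)+
  qed
  have "\<bar>n \<bullet> x'\<bar> \<le> 0"
  proof (rule field_le_epsilon)
    fix e :: real assume "e > 0"
    have "\<bar>n \<bullet> x'\<bar> \<le> e / (norm x' + 1) * norm x'"
      using \<open>e > 0\<close> by (intro bound divide_pos_pos) (auto simp: add_nonneg_pos)
    also have "\<dots> \<le> e" using \<open>e > 0\<close> by (simp add: pos_divide_le_eq add_nonneg_pos mult_left_mono)
    finally show "\<bar>n \<bullet> x'\<bar> \<le> 0 + e" by simp
  qed
  then show ?thesis by simp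
qed

lemma continuous_on_vector_derivative_Ici:
  assumes "\<And>s. s \<ge> b \<Longrightarrow> (q has_vector_derivative q' s) (at s within {b..})" "T \<subseteq> {b..}"
  shows "continuous_on T q"
  using assms by (intro continuous_on_subset[OF continuous_on_vector_derivative, of "{b..}" q q']) auto

lemma exp_decay_of_derivative_le:
  fixes q :: "real \<Rightarrow> real"
  assumes q: "\<And>s. s \<ge> b \<Longrightarrow> (q has_vector_derivative q' s) (at s within {b..})"
    and le: "\<And>s. s \<ge> b \<Longrightarrow> q' s \<le> - \<mu> * q s" and "s \<ge> b"
  shows "q s \<le> q b * exp (- \<mu> * (s - b))"
proof -
  let ?F = "\<lambda>r. q r * exp (\<mu> * (r - b))"
  have "?F s \<le> ?F b"
  proof (rule DERIV_nonpos_imp_decreasing_open[of b s ?F])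
    fix r assume r: "b < r" "r < s"
    have "at r within {b..} = at r"
      using r by (intro at_within_interior) (simp add: interior_Ici[of "b - 1"])
    then have "(q has_real_derivative q' r) (at r)"
      using q[of r] r by (simp add: has_real_derivative_iff_has_vector_derivative)
    then have "(?F has_real_derivative (q' r * exp (\<mu> * (r - b)) + q r * (\<mu> * exp (\<mu> * (r - b))))) (at r)"
      by (auto intro!: derivative_eq_intros)
    moreover have "(q' r + \<mu> * q r) * exp (\<mu> * (r - b)) \<le> 0"
      using le[of r] r by (intro mult_nonpos_nonneg) auto
    ultimately show "\<exists>y. (?F has_real_derivative y) (at r) \<and> y \<le> 0"
      by (auto simp: algebra_simps)
  next
    have "continuous_on {b..s} q"
      using q by (rule continuous_on_vector_derivative_Ici) auto
    then show "continuous_on {b..s} ?F" by (intro continuous_intros)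
  qed (use \<open>s \<ge> b\<close> in simp)
  then show ?thesis
    using pos_le_divide_eq[of "exp (\<mu> * (s - b))" "q s" "q b"]
    by (simp add: exp_minus divide_inverse)
qed

text \<open>Since \<open>(|w|\<^sup>2)' = - 2 w \<bullet> A w\<close> and \<open>w\<close> becomes parallel to a left eigenvector of the
  limit of \<open>A\<close> with eigenvalue \<open>\<mu>\<close>, the decay rate of \<open>|w|\<^sup>2\<close> is eventually at least \<open>\<mu>\<close>.\<close>
lemma adjoint_solution_decay:
  fixes w n :: "real \<Rightarrow> real^3" and A :: "real \<Rightarrow> real^3^3"
  assumes w: "\<And>s. s \<ge> p \<Longrightarrow> (w has_vector_derivative - (transpose (A s) *v w s)) (at s within {p..})"
    and A: "(A \<longlongrightarrow> A0) at_top" and n: "(n \<longlongrightarrow> n0) at_top" "n0 \<noteq> 0"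
    and n0: "\<And>x. n0 \<bullet> (A0 *v x) = \<mu> * (n0 \<bullet> x)" and "\<mu> > 0"
    and par: "\<And>s. s \<ge> p \<Longrightarrow> n s \<noteq> 0 \<Longrightarrow> \<exists>c. w s = c *\<^sub>R n s"
  obtains D \<kappa> where "D \<ge> 0" "\<kappa> > 0" "\<And>s. s \<ge> p \<Longrightarrow> norm (w s) \<le> D * exp (- \<kappa> * (s - p))"
proof -
  have "((\<lambda>s. n s \<bullet> (A s *v n s) - \<mu> / 2 * (n s \<bullet> n s)) \<longlongrightarrow> n0 \<bullet> (A0 *v n0) - \<mu> / 2 * (n0 \<bullet> n0)) at_top"
    unfolding matrix_vector_mult_def
    by (intro tendsto_intros A n)
  moreover have "n0 \<bullet> (A0 *v n0) - \<mu> / 2 * (n0 \<bullet> n0) > 0"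
    using n0[of n0] \<open>\<mu> > 0\<close> \<open>n0 \<noteq> 0\<close> by simp
  ultimately have "\<forall>\<^sub>F s in at_top. n s \<bullet> (A s *v n s) - \<mu> / 2 * (n s \<bullet> n s) > 0"
    by (rule order_tendstoD)
  moreover have "\<forall>\<^sub>F s in at_top. n s \<noteq> 0"
    using n by (rule tendsto_imp_eventually_ne)
  ultimately have "\<forall>\<^sub>F s in at_top. n s \<bullet> (A s *v n s) - \<mu> / 2 * (n s \<bullet> n s) > 0 \<and> n s \<noteq> 0"
    by (rule eventually_conj)
  then obtain b0 where b0: "\<And>s. s \<ge> b0 \<Longrightarrow> n s \<bullet> (A s *v n s) > \<mu> / 2 * (n s \<bullet> n s) \<and> n s \<noteq> 0"
    unfolding eventually_at_top_linorder by auto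
  define b where "b = max b0 p"
  have growth: "\<mu> / 2 * (w s \<bullet> w s) \<le> w s \<bullet> (A s *v w s)" if "s \<ge> b" for s
  proof -
    have "s \<ge> p" "s \<ge> b0" using that by (auto simp: b_def)
    then obtain c where "w s = c *\<^sub>R n s" using par b0 by meson
    moreover have "c\<^sup>2 * (\<mu> / 2 * (n s \<bullet> n s)) \<le> c\<^sup>2 * (n s \<bullet> (A s *v n s))"
      using b0[of s] that by (intro mult_left_mono) (auto simp: b_def)
    ultimately show ?thesis
      by (simp add: matrix_vector_mult_scaleR power2_eq_square mult_ac)
  qed
  have decay: "w s \<bullet> w s \<le> (w b \<bullet> w b) * exp (- \<mu> * (s - b))" if "s \<ge> b" for s
  proof (rule exp_decay_of_derivative_le[OF _ _ that])
    fix r assume r: "r \<ge> b"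
    have "(w has_vector_derivative - (transpose (A r) *v w r)) (at r within {b..})"
      using r by (intro has_vector_derivative_within_subset[OF w]) (auto simp: b_def)
    then show "((\<lambda>s. w s \<bullet> w s) has_vector_derivative
        (w r \<bullet> (- (transpose (A r) *v w r)) + (- (transpose (A r) *v w r)) \<bullet> w r)) (at r within {b..})"
      by (intro bounded_bilinear.has_vector_derivative[OF bounded_bilinear_inner])
    have "(transpose (A r) *v w r) \<bullet> w r = w r \<bullet> (A r *v w r)"
      by (simp add: dot_lmul_matrix)
    then show "w r \<bullet> (- (transpose (A r) *v w r)) + (- (transpose (A r) *v w r)) \<bullet> w r \<le> - \<mu> * (w r \<bullet> w r)"
      using growth[OF r] by (simp add: inner_commute)
  qed
  have "continuous_on {p..b} w"
    using w by (rule continuous_on_vector_derivative_Ici) auto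
  then have "bounded (w ` {p..b})"
    by (intro compact_imp_bounded compact_continuous_image) auto
  then obtain C where C: "\<And>s. s \<in> {p..b} \<Longrightarrow> norm (w s) \<le> C"
    unfolding bounded_iff by (meson imageI)
  have "p \<in> {p..b}" by (simp add: b_def)
  then have "0 \<le> C" using C norm_ge_zero order_trans by blast
  show thesis
  proof
    show "0 \<le> C * exp (\<mu> / 2 * (b - p))" "0 < \<mu> / 2" using \<open>0 \<le> C\<close> \<open>\<mu> > 0\<close> by auto
    fix s assume "s \<ge> p"
    have "norm (w s) \<le> C * exp (- (\<mu> / 2) * (s - b))"
    proof (cases "s \<le> b")
      case True
      then have "1 \<le> exp (- (\<mu> / 2) * (s - b))" using \<open>\<mu> > 0\<close> by (simp add: mult_nonneg_nonpos)
      from mult_left_mono[OF this \<open>0 \<le> C\<close>] C[of s] True \<open>s \<ge> p\<close> show ?thesis by simp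
    next
      case False
      have "(norm (w s))\<^sup>2 \<le> (norm (w b) * exp (- (\<mu> / 2) * (s - b)))\<^sup>2"
        using decay[of s] False
        by (simp add: power2_norm_eq_inner power_mult_distrib flip: exp_double)
      then have "norm (w s) \<le> norm (w b) * exp (- (\<mu> / 2) * (s - b))"
        by (rule power2_le_imp_le) simp
      also have "\<dots> \<le> C * exp (- (\<mu> / 2) * (s - b))"
        using C[of b] by (intro mult_right_mono) (auto simp: b_def)
      finally show ?thesis .
    qed
    also have "- (\<mu> / 2) * (s - b) = \<mu> / 2 * (b - p) + - (\<mu> / 2) * (s - p)"
      by (simp add: field_simps)
    also have "C * exp \<dots> = C * exp (\<mu> / 2 * (b - p)) * exp (- (\<mu> / 2) * (s - p))"
      by (simp only: exp_add mult.assoc)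
    finally show "norm (w s) \<le> C * exp (\<mu> / 2 * (b - p)) * exp (- (\<mu> / 2) * (s - p))" .
  qed
qed

text \<open>Integrability holds because on bounded intervals \<open>w \<bullet> h\<close> is the uniform limit, as
  \<open>\<epsilon> \<rightarrow> 0\<close>, of \<open>(w \<bullet> u\<^sub>\<epsilon>)' / \<epsilon>\<close>, which is integrable because it is a derivative.\<close>
lemma adjoint_pairing_expansion:
  fixes w h :: "real \<Rightarrow> real^3" and A :: "real \<Rightarrow> real^3^3" and d :: "real \<Rightarrow> real^3"
  assumes w: "\<And>s. s \<ge> p \<Longrightarrow> (w has_vector_derivative - (transpose (A s) *v w s)) (at s within {p..})"
    and decay: "\<And>s. s \<ge> p \<Longrightarrow> norm (w s) \<le> D * exp (- \<kappa> * (s - p))" and "\<kappa> > 0" "D \<ge> 0"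
    and h: "\<And>s. s \<ge> p \<Longrightarrow> norm (h s) \<le> B"
    and u: "\<And>\<epsilon>. \<lbrakk>0 < \<epsilon>; \<epsilon> \<le> \<epsilon>1\<rbrakk> \<Longrightarrow> \<exists>u r. u p = d \<epsilon> \<and> (\<forall>s\<ge>p. norm (u s) \<le> K * \<epsilon> \<and> norm (r s) \<le> C * \<epsilon>\<^sup>2 \<and>
         (u has_vector_derivative A s *v u s + \<epsilon> *\<^sub>R h s + r s) (at s within {p..}))"
    and "\<epsilon>1 > 0"
  shows "(\<lambda>s. w s \<bullet> h s) integrable_on {p..}"
    and "\<And>\<epsilon>. \<lbrakk>0 < \<epsilon>; \<epsilon> \<le> \<epsilon>1\<rbrakk> \<Longrightarrow>
      \<bar>w p \<bullet> d \<epsilon> + \<epsilon> * integral {p..} (\<lambda>s. w s \<bullet> h s)\<bar> \<le> D * C / \<kappa> * \<epsilon>\<^sup>2"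
proof -
  have ftc: "((\<lambda>s. w s \<bullet> (\<epsilon> *\<^sub>R h s + r s)) has_integral w S \<bullet> u S - w p \<bullet> u p) {p..S}"
    if "\<And>s. s \<ge> p \<Longrightarrow> (u has_vector_derivative A s *v u s + \<epsilon> *\<^sub>R h s + r s) (at s within {p..})" "p \<le> S"
    for u r \<epsilon> S
  proof (rule fundamental_theorem_of_calculus[OF \<open>p \<le> S\<close>])
    fix s assume s: "s \<in> {p..S}"
    have "((\<lambda>s. w s \<bullet> u s) has_vector_derivative
        w s \<bullet> (A s *v u s + \<epsilon> *\<^sub>R h s + r s) + (- (transpose (A s) *v w s)) \<bullet> u s) (at s within {p..})"
      using s by (intro bounded_bilinear.has_vector_derivative[OF bounded_bilinear_inner] w that) auto
    moreover have "(transpose (A s) *v w s) \<bullet> u s = w s \<bullet> (A s *v u s)"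
      by (simp add: dot_lmul_matrix)
    ultimately show "((\<lambda>s. w s \<bullet> u s) has_vector_derivative w s \<bullet> (\<epsilon> *\<^sub>R h s + r s)) (at s within {p..S})"
      by (auto simp: inner_add_right intro: has_vector_derivative_within_subset)
  qed
  have DC: "norm (w s \<bullet> v) \<le> D * exp (- \<kappa> * (s - p)) * b" if "p \<le> s" "norm v \<le> b" for s v b
  proof -
    have "norm (w s \<bullet> v) \<le> norm (w s) * norm v" by (simp add: Cauchy_Schwarz_ineq2)
    also have "\<dots> \<le> D * exp (- \<kappa> * (s - p)) * b"
      using decay that \<open>D \<ge> 0\<close> by (intro mult_mono) auto
    finally show ?thesis .
  qed
  have exp_le: "exp (- \<kappa> * (s - p)) \<le> 1" if "p \<le> s" for s
    using that \<open>\<kappa> > 0\<close> by simp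
  have "C * \<epsilon>1\<^sup>2 \<ge> 0"
    using u[OF \<open>\<epsilon>1 > 0\<close> order_refl] by (meson norm_ge_zero order_refl order_trans)
  then have "C \<ge> 0" using \<open>\<epsilon>1 > 0\<close> by (simp add: zero_le_mult_iff)
  have "B \<ge> 0" using h[of p] norm_ge_zero order_trans by blast
  have int_fin: "(\<lambda>s. w s \<bullet> h s) integrable_on {p..S}" for S
  proof (cases "p \<le> S")
    case True
    have "(\<lambda>s. w s \<bullet> h s) integrable_on cbox p S"
    proof (rule integrable_uniform_limit)
      fix e :: real assume "e > 0"
      define \<epsilon> where "\<epsilon> = min \<epsilon>1 (e / (D * C + 1))"
      have DC1: "D * C + 1 > 0" using \<open>D \<ge> 0\<close> \<open>C \<ge> 0\<close> by (simp add: add_nonneg_pos)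
      have \<epsilon>: "0 < \<epsilon>" "\<epsilon> \<le> \<epsilon>1" "\<epsilon> \<le> e / (D * C + 1)"
        using \<open>e > 0\<close> \<open>\<epsilon>1 > 0\<close> DC1 by (auto simp: \<epsilon>_def)
      obtain u r where ur: "\<And>s. p \<le> s \<Longrightarrow> norm (r s) \<le> C * \<epsilon>\<^sup>2"
        "\<And>s. p \<le> s \<Longrightarrow> (u has_vector_derivative A s *v u s + \<epsilon> *\<^sub>R h s + r s) (at s within {p..})"
        using u[OF \<epsilon>(1,2)] by blast
      define G where "G s = (w s \<bullet> (\<epsilon> *\<^sub>R h s + r s)) / \<epsilon>" for s
      have "G integrable_on {p..S}"
        unfolding G_def divide_inverse using ftc[OF ur(2) True] by (intro integrable_on_mult_left) blast
      moreover have "norm (w s \<bullet> h s - G s) \<le> e" if "s \<in> cbox p S" for s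
      proof -
        have "p \<le> s" using that by simp
        have "w s \<bullet> h s - G s = - (w s \<bullet> r s) / \<epsilon>"
          using \<epsilon>(1) by (simp add: G_def inner_add_right field_simps)
        then have "norm (w s \<bullet> h s - G s) = norm (w s \<bullet> r s) / \<epsilon>" using \<epsilon>(1) by simp
        also have "\<dots> \<le> D * exp (- \<kappa> * (s - p)) * (C * \<epsilon>\<^sup>2) / \<epsilon>"
          using DC[OF \<open>p \<le> s\<close> ur(1)[OF \<open>p \<le> s\<close>]] \<epsilon>(1) by (intro divide_right_mono) auto
        also have "\<dots> = D * C * \<epsilon> * exp (- \<kappa> * (s - p))"
          using \<epsilon>(1) by (simp add: power2_eq_square)
        also have "\<dots> \<le> D * C * \<epsilon> * 1"
          using \<open>D \<ge> 0\<close> \<open>C \<ge> 0\<close> \<epsilon>(1) exp_le[OF \<open>p \<le> s\<close>] by (intro mult_left_mono) auto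
        also have "\<dots> \<le> (D * C + 1) * \<epsilon>" using \<epsilon>(1) by (simp add: algebra_simps)
        also have "\<dots> \<le> e" using \<epsilon>(3) DC1 by (simp add: field_simps)
        finally show ?thesis .
      qed
      ultimately show "\<exists>G. (\<forall>s\<in>cbox p S. norm (w s \<bullet> h s - G s) \<le> e) \<and> G integrable_on cbox p S"
        by (intro exI[of _ G]) auto
    qed
    then show ?thesis by simp
  qed (simp add: integrable_on_empty)
  have exp_int: "((\<lambda>s. D * exp (- \<kappa> * (s - p)) * b) has_integral D * exp (- \<kappa> * (S - p)) / \<kappa> * b) {S..}" for S b
  proof -
    have "((\<lambda>s. (D * exp (\<kappa> * p) * b) * exp (- \<kappa> * s)) has_integral
        (D * exp (\<kappa> * p) * b) * (exp (- \<kappa> * S) / \<kappa>)) {S..}"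
      by (intro has_integral_mult_right has_integral_exp_minus_to_infinity \<open>\<kappa> > 0\<close>)
    moreover have "exp (- \<kappa> * (s - p)) = exp (\<kappa> * p) * exp (- \<kappa> * s)" for s
      by (simp add: algebra_simps flip: exp_add)
    ultimately show ?thesis by (simp add: mult_ac)
  qed
  have int_tail: "(\<lambda>s. w s \<bullet> h s) integrable_on {S..}" if "p \<le> S" for S
  proof (rule integrable_on_all_intervals_integrable_bound[where g = "\<lambda>s. D * exp (- \<kappa> * (s - p)) * B"])
    fix a b :: real
    have "(\<lambda>s. w s \<bullet> h s) integrable_on {max S a..b}"
      by (rule integrable_on_subinterval[OF int_fin[of b]]) (use that in auto)
    moreover have "{S..} \<inter> cbox a b = {max S a..b}" by auto
    ultimately show "(\<lambda>x. if x \<in> {S..} then w x \<bullet> h x else 0) integrable_on cbox a b"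
      by (simp only: integrable_restrict_Int)
  qed (use that DC h has_integral_integrable[OF exp_int] in auto)
  then show "(\<lambda>s. w s \<bullet> h s) integrable_on {p..}"
    by simp
  fix \<epsilon> assume \<epsilon>: "0 < \<epsilon>" "\<epsilon> \<le> \<epsilon>1"
  obtain u r where u0: "u p = d \<epsilon>"
    and ur: "\<And>s. p \<le> s \<Longrightarrow> norm (u s) \<le> K * \<epsilon>" "\<And>s. p \<le> s \<Longrightarrow> norm (r s) \<le> C * \<epsilon>\<^sup>2"
      "\<And>s. p \<le> s \<Longrightarrow> (u has_vector_derivative A s *v u s + \<epsilon> *\<^sub>R h s + r s) (at s within {p..})"
    using u[OF \<epsilon>] by blast
  let ?I = "\<lambda>X. integral X (\<lambda>s. w s \<bullet> h s)"
  have est: "\<bar>w p \<bullet> d \<epsilon> + \<epsilon> * ?I {p..}\<bar> \<le>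
      D * C / \<kappa> * \<epsilon>\<^sup>2 + exp (- \<kappa> * (S - p)) * (D * (K * \<epsilon>) + \<epsilon> * (D / \<kappa> * B))" if "S \<ge> p" for S
  proof -
    have "((\<lambda>s. w s \<bullet> (\<epsilon> *\<^sub>R h s + r s) - \<epsilon> * (w s \<bullet> h s)) has_integral
        (w S \<bullet> u S - w p \<bullet> u p) - \<epsilon> * ?I {p..S}) {p..S}"
      by (intro has_integral_diff ftc[OF ur(3) that] has_integral_mult_right integrable_integral int_fin)
    then have R: "((\<lambda>s. w s \<bullet> r s) has_integral (w S \<bullet> u S - w p \<bullet> u p) - \<epsilon> * ?I {p..S}) {p..S}"
      by (simp add: inner_add_right)
    have bd_int: "(\<lambda>s. D * exp (- \<kappa> * (s - p)) * b) integrable_on {p..S}" for b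
      by (intro integrable_continuous_interval continuous_intros)
    have "norm (integral {p..S} (\<lambda>s. w s \<bullet> r s)) \<le> integral {p..S} (\<lambda>s. D * exp (- \<kappa> * (s - p)) * (C * \<epsilon>\<^sup>2))"
      using R DC ur(2) by (intro integral_norm_bound_integral bd_int) auto
    also have "\<dots> \<le> integral {p..} (\<lambda>s. D * exp (- \<kappa> * (s - p)) * (C * \<epsilon>\<^sup>2))"
      using \<open>D \<ge> 0\<close> \<open>C \<ge> 0\<close> has_integral_integrable[OF exp_int]
      by (intro integral_subset_le bd_int) auto
    also have "\<dots> = D * C / \<kappa> * \<epsilon>\<^sup>2"
      using integral_unique[OF exp_int[of "C * \<epsilon>\<^sup>2" p]] by simp
    finally have R': "\<bar>w S \<bullet> u S - w p \<bullet> d \<epsilon> - \<epsilon> * ?I {p..S}\<bar> \<le> D * C / \<kappa> * \<epsilon>\<^sup>2"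
      using integral_unique[OF R] u0 by simp
    have wu: "\<bar>w S \<bullet> u S\<bar> \<le> exp (- \<kappa> * (S - p)) * (D * (K * \<epsilon>))"
      using DC[OF that ur(1)[OF that]] by (simp add: mult_ac)
    have "norm (?I {S..}) \<le> integral {S..} (\<lambda>s. D * exp (- \<kappa> * (s - p)) * B)"
      using that DC h has_integral_integrable[OF exp_int]
      by (intro integral_norm_bound_integral int_tail) auto
    also have "\<dots> = exp (- \<kappa> * (S - p)) * (D / \<kappa> * B)"
      using integral_unique[OF exp_int[of B S]] by simp
    finally have "norm (?I {S..}) \<le> exp (- \<kappa> * (S - p)) * (D / \<kappa> * B)" .
    from mult_left_mono[OF this less_imp_le[OF \<epsilon>(1)]]
    have tail: "\<bar>\<epsilon> * ?I {S..}\<bar> \<le> \<epsilon> * (exp (- \<kappa> * (S - p)) * (D / \<kappa> * B))"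
      by (simp only: real_norm_def abs_mult abs_of_pos[OF \<epsilon>(1)])
    have "{p..S} \<inter> {S..} = {S}" "{p..S} \<union> {S..} = {p..}" using that by auto
    then have split: "?I {p..} = ?I {p..S} + ?I {S..}"
      using integral_Un[OF int_fin[of S] int_tail[OF that]] by simp
    have decomp: "w p \<bullet> d \<epsilon> + \<epsilon> * ?I {p..} =
        w S \<bullet> u S - (w S \<bullet> u S - w p \<bullet> d \<epsilon> - \<epsilon> * ?I {p..S}) + \<epsilon> * ?I {S..}"
      unfolding split distrib_left by simp
    have triangle: "\<bar>X - Y + Z\<bar> \<le> \<bar>X\<bar> + \<bar>Y\<bar> + \<bar>Z\<bar>" for X Y Z :: real
      by linarith
    have "\<bar>w p \<bullet> d \<epsilon> + \<epsilon> * ?I {p..}\<bar> \<le> exp (- \<kappa> * (S - p)) * (D * (K * \<epsilon>)) + D * C / \<kappa> * \<epsilon>\<^sup>2 +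
        \<epsilon> * (exp (- \<kappa> * (S - p)) * (D / \<kappa> * B))"
      unfolding decomp by (rule order_trans[OF triangle add_mono[OF add_mono[OF wu R'] tail]])
    then show ?thesis
      by (simp only: distrib_left mult.left_commute add_ac)
  qed
  show "\<bar>w p \<bullet> d \<epsilon> + \<epsilon> * ?I {p..}\<bar> \<le> D * C / \<kappa> * \<epsilon>\<^sup>2"
  proof (rule tendsto_lowerbound)
    have "((\<lambda>S. exp (- \<kappa> * (S - p))) \<longlongrightarrow> 0) at_top"
    proof (rule filterlim_compose[OF exp_at_bot])
      show "filterlim (\<lambda>S. - \<kappa> * (S - p)) at_bot at_top"
        using \<open>\<kappa> > 0\<close> filterlim_tendsto_add_at_top[OF tendsto_const filterlim_ident, of "- p"]
        by (intro filterlim_tendsto_neg_mult_at_bot[OF tendsto_const]) auto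
    qed
    from tendsto_add[OF tendsto_const tendsto_mult_left_zero[OF this]]
    show "((\<lambda>S. D * C / \<kappa> * \<epsilon>\<^sup>2 + exp (- \<kappa> * (S - p)) * (D * (K * \<epsilon>) + \<epsilon> * (D / \<kappa> * B)))
        \<longlongrightarrow> D * C / \<kappa> * \<epsilon>\<^sup>2) at_top"
      by (simp only: add_0_right)
    show "\<forall>\<^sub>F S in at_top. \<bar>w p \<bullet> d \<epsilon> + \<epsilon> * ?I {p..}\<bar> \<le>
      D * C / \<kappa> * \<epsilon>\<^sup>2 + exp (- \<kappa> * (S - p)) * (D * (K * \<epsilon>) + \<epsilon> * (D / \<kappa> * B))"
      using est eventually_ge_at_top by (rule eventually_mono[rotated])
  qed simp
qed

lemma C2_on_has_derivative_jacobian: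
  fixes f :: "real^'n \<Rightarrow> real^'m"
  assumes "C2_on f S" "open S" "x \<in> S"
  shows "(f has_derivative (\<lambda>h. jacobian f (at x) *v h)) (at x)"
  using assms jacobian_works[of f "at x"] at_within_open[OF assms(3,2)]
  unfolding C2_on_def differentiable_def by metis

lemma C2_on_continuous_jacobian:
  fixes f :: "real^'n \<Rightarrow> real^'m"
  assumes "C2_on f S" "open S"
  shows "continuous_on S (\<lambda>x. jacobian f (at x))"
proof -
  from assms obtain f' where f': "\<And>x. x \<in> S \<Longrightarrow> (f has_derivative blinfun_apply (f' x)) (at x)"
    and C1: "C1_on f' S"
    unfolding C2_on_def by (metis at_within_open)
  from C1 obtain f'' where "\<And>x. x \<in> S \<Longrightarrow> (f' has_derivative blinfun_apply (f'' x)) (at x within S)"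
    unfolding C1_on_def by blast
  then have "continuous_on S f'"
    by (rule has_derivative_continuous_on)
  then have "continuous_on S (\<lambda>x. \<chi> i j. blinfun_apply (f' x) (axis j 1) $ i)"
    by (intro continuous_intros)
  moreover have "jacobian f (at x) = (\<chi> i j. blinfun_apply (f' x) (axis j 1) $ i)" if "x \<in> S" for x
    using frechet_derivative_at[OF f'[OF that]] by (simp add: jacobian_def matrix_def)
  ultimately show ?thesis by (simp cong: continuous_on_cong)
qed

lemma continuous_on_matrix_vector_mult:
  fixes A :: "'a::topological_space \<Rightarrow> real^'n^'m"
  assumes "continuous_on S A" "continuous_on S v"
  shows "continuous_on S (\<lambda>z. A z *v v z)"
  unfolding matrix_vector_mult_def
  by (intro continuous_intros continuous_on_sum continuous_on_mult continuous_on_component assms)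

lemma C2_on_uniform_taylor:
  fixes f :: "real^'n \<Rightarrow> real^'m"
  assumes "C2_on f S" "open S" "compact T" "T \<subseteq> S"
  obtains r C where "r > 0" "C \<ge> 0" "\<And>x. x \<in> T \<Longrightarrow> cball x r \<subseteq> S"
    "\<And>x y. \<lbrakk>x \<in> T; norm (y - x) \<le> r\<rbrakk> \<Longrightarrow>
      norm (f y - f x - jacobian f (at x) *v (y - x)) \<le> C * (norm (y - x))\<^sup>2"
proof (cases "T = {}")
  case True
  then show thesis using that[of 1 0] by simp
next
  case False
  from assms(3) False assms(2,4) obtain r where r: "r > 0" "{x. infdist x T \<le> r} \<subseteq> S"
    by (metis compact_in_open_separated)
  let ?N = "{x. infdist x T \<le> r}"
  from assms(1,2) obtain f' where f': "\<And>x. x \<in> S \<Longrightarrow> (f has_derivative blinfun_apply (f' x)) (at x)"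
    and C1: "C1_on f' S"
    unfolding C2_on_def by (metis at_within_open)
  from C1 obtain f'' where f'': "\<And>x. x \<in> S \<Longrightarrow> (f' has_derivative blinfun_apply (f'' x)) (at x)"
    and cont: "continuous_on S f''"
    unfolding C1_on_def using assms(2) by (metis at_within_open)
  have "bounded (f'' ` ?N)"
    using compact_infdist_le[OF False assms(3) r(1)] cont r(2)
    by (intro compact_imp_bounded compact_continuous_image) (auto intro: continuous_on_subset)
  then obtain C where C: "\<And>x. x \<in> ?N \<Longrightarrow> norm (f'' x) \<le> C" "C > 0"
    unfolding bounded_pos by blast
  have ball_N: "cball x r \<subseteq> ?N" if "x \<in> T" for x
    using that by (auto intro: infdist_le2 simp: dist_commute)
  show thesis
  proof (rule that)
    show "0 < r" "0 \<le> C" by (fact, use C(2) in simp)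
    show "cball x r \<subseteq> S" if "x \<in> T" for x
      using ball_N[OF that] r(2) by blast
    fix x y assume x: "x \<in> T" and y: "norm (y - x) \<le> r"
    let ?B = "cball x (norm (y - x))"
    have B: "?B \<subseteq> ?N" using ball_N[OF x] y by (auto simp: subset_iff)
    then have B_S: "?B \<subseteq> S" using r(2) by blast
    have lip: "norm (f' z - f' x) \<le> C * norm (y - x)" if z: "z \<in> ?B" for z
    proof -
      have "norm (f' z - f' x) \<le> C * norm (z - x)"
      proof (rule differentiable_bound[OF convex_cball])
        show "(f' has_derivative blinfun_apply (f'' v)) (at v within ?B)" if "v \<in> ?B" for v
          using that B_S by (intro has_derivative_at_withinI[OF f'']) auto
        show "onorm (blinfun_apply (f'' v)) \<le> C" if "v \<in> ?B" for v
          using C(1)[of v] that B by (auto simp: norm_blinfun.rep_eq)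
      qed (use z in auto)
      also have "\<dots> \<le> C * norm (y - x)"
        using z C(2) by (simp add: dist_norm norm_minus_commute)
      finally show ?thesis .
    qed
    have "norm (f y - f x - blinfun_apply (f' x) (y - x)) \<le> norm (y - x) * (C * norm (y - x))"
    proof (rule differentiable_bound_linearization[where S = ?B and f' = "\<lambda>v. blinfun_apply (f' v)"])
      show "x + \<tau> *\<^sub>R (y - x) \<in> ?B" if "\<tau> \<in> {0..1}" for \<tau>
        using that by (simp add: dist_norm mult_left_le_one_le)
      show "(f has_derivative blinfun_apply (f' v)) (at v within ?B)" if "v \<in> ?B" for v
        using that B_S by (intro has_derivative_at_withinI[OF f']) auto
      show "onorm (blinfun_apply (f' v) - blinfun_apply (f' x)) \<le> C * norm (y - x)" if "v \<in> ?B" for v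
        using lip[OF that] by (simp add: norm_blinfun.rep_eq minus_blinfun.rep_eq fun_diff_def)
    qed simp
    moreover have "x \<in> S" using x assms(4) by blast
    then have "blinfun_apply (f' x) = (\<lambda>h. jacobian f (at x) *v h)"
      using f' C2_on_has_derivative_jacobian[OF assms(1,2)] has_derivative_unique by blast
    ultimately show "norm (f y - f x - jacobian f (at x) *v (y - x)) \<le> C * (norm (y - x))\<^sup>2"
      by (simp add: power2_eq_square mult_ac)
  qed
qed

lemma C2_on_lipschitz_of_jacobian_bound:
  fixes g :: "real^'n \<Rightarrow> real^'m" and G :: real
  assumes "C2_on g S" "open S" "convex U" "U \<subseteq> S"
    and G: "\<And>x. x \<in> S \<Longrightarrow> norm (jacobian g (at x)) \<le> G" and "x \<in> U" "y \<in> U"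
  shows "norm (g y - g x) \<le> CARD('m) * G * norm (y - x)"
proof (rule differentiable_bound[OF assms(3)])
  show "(g has_derivative (\<lambda>h. jacobian g (at v) *v h)) (at v within U)" if "v \<in> U" for v
    using C2_on_has_derivative_jacobian[OF assms(1,2)] that assms(4)
    by (blast intro: has_derivative_at_withinI)
  show "onorm (\<lambda>h. jacobian g (at v) *v h) \<le> CARD('m) * G" if "v \<in> U" for v
  proof (rule onorm_le)
    fix h
    have "norm (jacobian g (at v) *v h) \<le> CARD('m) * norm (jacobian g (at v)) * norm h"
      by (rule norm_matrix_vector_mult_le)
    also have "\<dots> \<le> CARD('m) * G * norm h"
      using G[of v] that assms(4) by (intro mult_right_mono mult_left_mono) auto
    finally show "norm (jacobian g (at v) *v h) \<le> CARD('m) * G * norm h" .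
  qed
qed fact+

lemma plane_normal:
  fixes L :: "real^2 \<Rightarrow> real^3"
  assumes "linear L"
  shows "cross3 (L (axis 1 1)) (L (axis 2 1)) \<bullet> L h = 0"
    and "inj L \<Longrightarrow> cross3 (L (axis 1 1)) (L (axis 2 1)) \<noteq> 0"
proof -
  have "h = h $ 1 *\<^sub>R axis 1 1 + h $ 2 *\<^sub>R axis 2 1"
    by (simp add: vec_eq_iff forall_2 axis_def)
  from arg_cong[OF this, of L]
  have "L h = h $ 1 *\<^sub>R L (axis 1 1) + h $ 2 *\<^sub>R L (axis 2 1)"
    using assms by (simp only: linear_add linear_scale)
  then show "cross3 (L (axis 1 1)) (L (axis 2 1)) \<bullet> L h = 0"
    by (simp add: inner_add_right dot_cross_self)
  assume "inj L"
  have ne: "L v \<noteq> 0" if "v \<noteq> 0" for v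
    using that assms \<open>inj L\<close> linear_injective_0 by blast
  have ax: "(axis 1 1 :: real^2) \<noteq> 0" "(axis 2 1 :: real^2) \<noteq> 0"
    by (simp_all add: axis_eq_0_iff)
  show "cross3 (L (axis 1 1)) (L (axis 2 1)) \<noteq> 0"
  proof
    assume "cross3 (L (axis 1 1)) (L (axis 2 1)) = 0"
    then obtain c where "L (axis 2 1) = c *\<^sub>R L (axis 1 1)"
      using ne[OF ax(1)] ne[OF ax(2)] by (auto simp: cross_eq_0 collinear_lemma)
    then have "L (axis 2 1) = L (c *\<^sub>R axis 1 1)"
      using assms by (simp add: linear_scale)
    then have "(axis 2 1 :: real^2) = c *\<^sub>R axis 1 1"
      using \<open>inj L\<close> by (simp add: inj_eq)
    then show False
      by (simp add: vec_eq_iff forall_2 axis_def)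
  qed
qed

lemma trajectory_in_compact:
  fixes x :: "real \<Rightarrow> 'a::euclidean_space"
  assumes "continuous_on {p..} x" "(x \<longlongrightarrow> a) at_top" "open S" "a \<in> S" "x ` {p..} \<subseteq> S"
  obtains T where "compact T" "T \<subseteq> S" "x ` {p..} \<subseteq> T"
proof -
  obtain \<delta> where \<delta>: "\<delta> > 0" "cball a \<delta> \<subseteq> S"
    using assms(3,4) open_contains_cball by blast
  have "\<forall>\<^sub>F s in at_top. dist (x s) a < \<delta>"
    using assms(2) \<delta>(1) by (rule tendstoD)
  then obtain b where b: "\<And>s. s \<ge> b \<Longrightarrow> dist (x s) a < \<delta>"
    unfolding eventually_at_top_linorder by blast
  show thesis
  proof
    show "compact (x ` {p..b} \<union> cball a \<delta>)"
      by (intro compact_Un compact_continuous_image compact_cball continuous_on_subset[OF assms(1)]) auto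
    show "x ` {p..b} \<union> cball a \<delta> \<subseteq> S" using \<delta>(2) assms(5) by auto
    show "x ` {p..} \<subseteq> x ` {p..b} \<union> cball a \<delta>"
    proof
      fix z assume "z \<in> x ` {p..}"
      then obtain s where s: "s \<ge> p" "z = x s" by auto
      then show "z \<in> x ` {p..b} \<union> cball a \<delta>"
        using b[of s] by (cases "s \<le> b") (auto simp: dist_commute less_imp_le)
    qed
  qed
qed

theorem theorem2:
  fixes f :: "real^3 \<Rightarrow> real^3"
    and g :: "real^3 \<Rightarrow> real \<Rightarrow> real^3"
    and \<Omega> :: "(real^3) set"
    and a :: "real^3"
    and \<Phi> :: "real^2 \<Rightarrow> real^3" and V :: "(real^2) set"
    and xbar :: "real \<Rightarrow> real \<Rightarrow> real^3"
    and aeps :: "real \<Rightarrow> real \<Rightarrow> real^3"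
    and xs :: "real \<Rightarrow> real \<Rightarrow> real \<Rightarrow> real \<Rightarrow> real^3"
    and P T :: real
  assumes Omega: "open \<Omega>"
    and f_C2: "C2_on f \<Omega>"
    and Df_bounded: "bounded ((\<lambda>x. jacobian f (at x)) ` \<Omega>)"
    and g_C2: "\<And>t. C2_on (\<lambda>x. g x t) \<Omega>"
    and g_bounded: "bounded ((\<lambda>(x, t). g x t) ` (\<Omega> \<times> UNIV))"
    and Dg_bounded: "bounded ((\<lambda>(x, t). jacobian (\<lambda>z. g z t) (at x)) ` (\<Omega> \<times> UNIV))"
    and fixed_point: "a \<in> \<Omega>" "f a = 0"
    and spectrum: "saddle_2_stable (jacobian f (at a))"
    and manifold_C2: "C2_stable_manifold_chart f \<Omega> a \<Phi> V"
    and parametrization: "stable_manifold_parametrization f \<Omega> a \<Phi> V P xbar"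
    and lin_indep: "\<And>p \<alpha>. p \<ge> P \<Longrightarrow> \<alpha> \<in> {0..<1} \<Longrightarrow>
          f (xbar p \<alpha>) \<noteq> xbar_alpha xbar p \<alpha> \<and>
          independent {f (xbar p \<alpha>), xbar_alpha xbar p \<alpha>}"
    and persistence: "\<exists>\<epsilon>0>0. \<exists>C. \<forall>\<epsilon>\<in>{0..\<epsilon>0}.
          hyperbolic_trajectory (\<lambda>x t. f x + \<epsilon> *\<^sub>R g x t) \<Omega> (aeps \<epsilon>) \<and>
          (\<forall>t. norm (aeps \<epsilon> t - a) \<le> C * \<epsilon>)"
    and perturbed: "\<And>p \<alpha> t. p \<ge> P \<Longrightarrow> \<alpha> \<in> {0..<1} \<Longrightarrow> t \<ge> T \<Longrightarrow>
          \<exists>\<epsilon>0>0. \<exists>K. \<forall>\<epsilon>\<in>{0..\<epsilon>0}. \<exists>y.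
            y t = xs p \<alpha> \<epsilon> t \<and>
            solves_on (\<lambda>x t. f x + \<epsilon> *\<^sub>R g x t) \<Omega> y {t..} \<and>
            (\<forall>\<tau>\<ge>t. y \<tau> \<in> stable_manifold (\<lambda>x t. f x + \<epsilon> *\<^sub>R g x t) \<Omega> (aeps \<epsilon>) \<tau> \<and>
                     norm (y \<tau> - xbar (\<tau> - t + p) \<alpha>) \<le> K * \<epsilon>)"
  shows "\<forall>p\<ge>P. \<forall>\<alpha>\<in>{0..<1}. \<forall>t\<ge>T.
           melnikov_integrand f g xbar p \<alpha> t integrable_on {p..} \<and>
           (\<lambda>\<epsilon>. normal_displacement f xbar xs p \<alpha> \<epsilon> t
                 - \<epsilon> * (melnikov f g xbar p \<alpha> t / norm (normal_vec f xbar p \<alpha>)))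
             \<in> O[at_right 0](\<lambda>\<epsilon>. \<epsilon>\<^sup>2)"
proof (intro allI ballI impI)
  fix p \<alpha> t :: real
  assume p: "p \<ge> P" and \<alpha>: "\<alpha> \<in> {0..<1}" and t: "t \<ge> T"
  from parametrization have sol: "\<And>\<alpha>. solves_on (\<lambda>x t. f x) \<Omega> (\<lambda>p. xbar p \<alpha>) {P..}"
    and lim_xbar: "\<And>\<alpha>. ((\<lambda>p. xbar p \<alpha>) \<longlongrightarrow> a) at_top"
    and C1: "C1_on (\<lambda>(p, \<alpha>). xbar p \<alpha>) ({P..} \<times> UNIV)"
    and cont_v: "continuous_on ({P..} \<times> UNIV) (\<lambda>(p, \<alpha>). the_inv_into V \<Phi> (xbar p \<alpha>))"
    and lim_v: "((\<lambda>p. the_inv_into V \<Phi> (xbar p \<alpha>)) \<longlongrightarrow> 0) at_top"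
    unfolding stable_manifold_parametrization_def by blast+
  let ?X = "\<lambda>(p, \<alpha>). xbar p \<alpha>" and ?D = "{P..} \<times> (UNIV :: real set)"
  from C1 obtain X' where X': "\<And>z. z \<in> ?D \<Longrightarrow> (?X has_derivative blinfun_apply (X' z)) (at z within ?D)"
    and cont_X': "continuous_on ?D X'"
    unfolding C1_on_def by blast
  have cont_X: "continuous_on ?D ?X" using X' by (rule has_derivative_continuous_on)
  have X'_alpha: "((\<lambda>\<beta>. xbar q \<beta>) has_vector_derivative X' (q, \<beta>) (0, 1)) (at \<beta>)" if "q \<ge> P" for q \<beta>
  proof -
    have "((\<lambda>\<beta>. (q, \<beta>)) has_derivative (\<lambda>h. (0, h))) (at \<beta>)"
      by (auto intro!: derivative_eq_intros)
    moreover have "(?X has_derivative blinfun_apply (X' (q, \<beta>))) (at (q, \<beta>) within range (Pair q))"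
      using that by (intro has_derivative_subset[OF X']) auto
    ultimately have "((\<lambda>\<beta>. ?X (q, \<beta>)) has_derivative (\<lambda>h. X' (q, \<beta>) (0, h))) (at \<beta>)"
      by (rule has_derivative_in_compose)
    moreover have "(\<lambda>h. X' (q, \<beta>) (0, h)) = (\<lambda>h. h *\<^sub>R X' (q, \<beta>) (0, 1))"
      by (simp flip: blinfun.scaleR_right)
    ultimately show ?thesis
      by (simp only: has_vector_derivative_def prod.case)
  qed
  then have xa: "xbar_alpha xbar q \<beta> = X' (q, \<beta>) (0, 1)" if "q \<ge> P" for q \<beta>
    unfolding xbar_alpha_def using that by (intro vector_derivative_at) auto
  have xa_deriv: "((\<lambda>\<beta>. xbar q \<beta>) has_vector_derivative xbar_alpha xbar q \<beta>) (at \<beta>)" if "q \<ge> P" for q \<beta>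
    using X'_alpha xa that by simp
  have "continuous_on ?D (\<lambda>z. X' z (0, 1))" by (intro continuous_intros cont_X')
  then have cont_xa: "continuous_on ?D (\<lambda>(q, \<beta>). xbar_alpha xbar q \<beta>)"
    by (rule continuous_on_eq) (auto simp: xa)
  have xbar_in: "xbar q \<beta> \<in> \<Omega>" if "q \<ge> P" for q \<beta>
    using sol that by (simp add: solves_on_def)
  let ?J = "\<lambda>q \<beta>. jacobian f (at (xbar q \<beta>)) *v xbar_alpha xbar q \<beta>"
  have "continuous_on ?D (\<lambda>z. jacobian f (at (?X z)))"
    using xbar_in by (intro continuous_on_compose2[OF C2_on_continuous_jacobian[OF f_C2 Omega] cont_X]) auto
  then have cont_J: "continuous_on ?D (\<lambda>(q, \<beta>). ?J q \<beta>)"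
    using cont_xa unfolding case_prod_beta by (intro continuous_on_matrix_vector_mult)
  have cont_f: "continuous_on \<Omega> f"
    by (rule has_derivative_continuous_on[OF has_derivative_at_withinI[OF C2_on_has_derivative_jacobian[OF f_C2 Omega]]])
  have slice: "continuous_on {P..q} (\<lambda>\<xi>. F \<xi> \<beta>)" if "continuous_on ?D (\<lambda>(q, \<beta>). F q \<beta>)"
    for q \<beta> and F :: "real \<Rightarrow> real \<Rightarrow> real^3"
  proof -
    have "continuous_on {P..q} (\<lambda>\<xi>. (\<lambda>(q, \<beta>). F q \<beta>) (\<xi>, \<beta>))"
      by (rule continuous_on_compose2[OF that]) (auto intro!: continuous_intros)
    then show ?thesis by simp
  qed
  have cont_f_xbar: "continuous_on {P..q} (\<lambda>\<xi>. f (xbar \<xi> \<beta>))" for q \<beta>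
  proof (rule continuous_on_compose2[OF cont_f])
    show "continuous_on {P..q} (\<lambda>\<xi>. xbar \<xi> \<beta>)"
      by (rule slice[OF cont_X])
  qed (use xbar_in in auto)
  have flow: "xbar q \<beta> = xbar P \<beta> + integral {P..q} (\<lambda>\<xi>. f (xbar \<xi> \<beta>))" if "q \<ge> P" for q \<beta>
  proof -
    have "((\<lambda>\<xi>. f (xbar \<xi> \<beta>)) has_integral xbar q \<beta> - xbar P \<beta>) {P..q}"
      using sol[of \<beta>] that
      by (intro fundamental_theorem_of_calculus)
        (auto simp: solves_on_def intro: has_vector_derivative_within_subset)
    then show ?thesis by (simp add: integral_unique)
  qed
  have xa_int: "xbar_alpha xbar q \<alpha> = xbar_alpha xbar P \<alpha> + integral {P..q} (\<lambda>\<xi>. ?J \<xi> \<alpha>)" if "q \<ge> P" for q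
  proof -
    have "((\<lambda>\<beta>. integral (cbox P q) (\<lambda>\<xi>. f (xbar \<xi> \<beta>))) has_vector_derivative
        integral (cbox P q) (\<lambda>\<xi>. ?J \<xi> \<alpha>)) (at \<alpha> within UNIV)"
    proof (rule leibniz_rule_vector_derivative)
      fix \<beta> \<xi> :: real assume \<xi>: "\<xi> \<in> cbox P q"
      then have "(f has_derivative (\<lambda>h. jacobian f (at (xbar \<xi> \<beta>)) *v h)) (at (xbar \<xi> \<beta>))"
        using xbar_in by (intro C2_on_has_derivative_jacobian[OF f_C2 Omega]) auto
      from vector_derivative_diff_chain_within[OF xa_deriv has_derivative_at_withinI[OF this]] \<xi>
      show "((\<lambda>\<beta>. f (xbar \<xi> \<beta>)) has_vector_derivative ?J \<xi> \<beta>) (at \<beta> within UNIV)"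
        by (simp add: o_def)
    next
      show "(\<lambda>\<xi>. f (xbar \<xi> \<beta>)) integrable_on cbox P q" for \<beta>
        using cont_f_xbar by (auto intro: integrable_continuous_interval)
      have "continuous_on (UNIV \<times> cbox P q) (\<lambda>z. (\<lambda>(q, \<beta>). ?J q \<beta>) (snd z, fst z))"
        by (rule continuous_on_compose2[OF cont_J]) (auto intro!: continuous_intros)
      then show "continuous_on (UNIV \<times> cbox P q) (\<lambda>(\<beta>, \<xi>). ?J \<xi> \<beta>)"
        by (simp add: case_prod_beta)
    qed auto
    then have "((\<lambda>\<beta>. xbar P \<beta> + integral {P..q} (\<lambda>\<xi>. f (xbar \<xi> \<beta>))) has_vector_derivative
        xbar_alpha xbar P \<alpha> + integral {P..q} (\<lambda>\<xi>. ?J \<xi> \<alpha>)) (at \<alpha>)"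
      using xa_deriv[of P \<alpha>] by (intro has_vector_derivative_add) auto
    then have "((\<lambda>\<beta>. xbar q \<beta>) has_vector_derivative
        xbar_alpha xbar P \<alpha> + integral {P..q} (\<lambda>\<xi>. ?J \<xi> \<alpha>)) (at \<alpha>)"
      using flow[OF that] by simp
    then show ?thesis
      using xa_deriv[OF that] vector_derivative_unique_at by blast
  qed
  have xa_var: "((\<lambda>q. xbar_alpha xbar q \<alpha>) has_vector_derivative ?J s \<alpha>) (at s within {P..})"
    if "P \<le> s" for s
  proof -
    have "continuous_on {P..s + 1} (\<lambda>\<xi>. ?J \<xi> \<alpha>)"
      by (rule slice[OF cont_J])
    then have "((\<lambda>q. integral {P..q} (\<lambda>\<xi>. ?J \<xi> \<alpha>)) has_vector_derivative ?J s \<alpha>) (at s within {P..s + 1})"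
      using that by (intro integral_has_vector_derivative) auto
    then have "((\<lambda>q. xbar_alpha xbar P \<alpha> + integral {P..q} (\<lambda>\<xi>. ?J \<xi> \<alpha>)) has_vector_derivative 0 + ?J s \<alpha>)
        (at s within {P..s + 1})"
      by (intro has_vector_derivative_add has_vector_derivative_const)
    then have "((\<lambda>q. xbar_alpha xbar q \<alpha>) has_vector_derivative 0 + ?J s \<alpha>) (at s within {P..s + 1})"
    proof (rule has_vector_derivative_transform[rotated 2])
      show "xbar_alpha xbar q \<alpha> = xbar_alpha xbar P \<alpha> + integral {P..q} (\<lambda>\<xi>. ?J \<xi> \<alpha>)" if "q \<in> {P..s + 1}" for q
        using that by (intro xa_int) simp
    qed (use that in simp)
    moreover have "at s within {P..s + 1} = at s within {P..}"
      by (rule at_within_nhd[of _ "{..<s + 1}"]) auto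
    ultimately show ?thesis
      by (simp only: add_0_left)
  qed
  define x where "x s = xbar s \<alpha>" for s
  define A where "A s = jacobian f (at (x s))" for s
  define h where "h s = g (x s) (s + t - p)" for s
  define w where "w s = exp (- integral {p..s} (\<lambda>\<xi>. divergence f (xbar \<xi> \<alpha>))) *\<^sub>R normal_vec f xbar s \<alpha>" for s
  have x_in: "x s \<in> \<Omega>" and x': "(x has_vector_derivative f (x s)) (at s within {p..})" if "s \<ge> p" for s
  proof -
    show "x s \<in> \<Omega>" using sol[of \<alpha>] p that by (simp add: solves_on_def x_def)
    have "(x has_vector_derivative f (x s)) (at s within {P..})"
      using sol[of \<alpha>] p that by (simp add: solves_on_def x_def[abs_def])
    then show "(x has_vector_derivative f (x s)) (at s within {p..})"
      by (rule has_vector_derivative_within_subset) (use p in auto)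
  qed
  have x_lim: "(x \<longlongrightarrow> a) at_top" using lim_xbar by (simp add: x_def[abs_def])
  have w': "(w has_vector_derivative - (transpose (A s) *v w s)) (at s within {p..})" if "p \<le> s" for s
  proof -
    let ?div = "\<lambda>\<xi>. divergence f (xbar \<xi> \<alpha>)" and ?A = "jacobian f (at (xbar s \<alpha>))"
    let ?N = "\<lambda>s. normal_vec f xbar s \<alpha>"
    have "P \<le> s" using p that by simp
    have x': "((\<lambda>q. xbar q \<alpha>) has_vector_derivative f (xbar q \<alpha>)) (at q within {P..})"
      if "P \<le> q" for q
      using sol[of \<alpha>] that by (auto simp: solves_on_def)
    have "continuous_on {P..} (\<lambda>q. xbar q \<alpha>)"
      by (rule continuous_on_vector_derivative_Ici[OF x']) auto
    then have "continuous_on {P..} (\<lambda>q. jacobian f (at (xbar q \<alpha>)))"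
      by (rule continuous_on_compose2[OF C2_on_continuous_jacobian[OF f_C2 Omega]]) (use xbar_in in auto)
    then have cont_div: "continuous_on {P..} ?div"
      unfolding divergence_def trace_def by (intro continuous_intros)
    have N': "(?N has_vector_derivative trace ?A *\<^sub>R ?N s - transpose ?A *v ?N s) (at s within {P..})"
    proof -
      have "(f has_derivative (\<lambda>h. ?A *v h)) (at (xbar s \<alpha>))"
        by (rule C2_on_has_derivative_jacobian[OF f_C2 Omega xbar_in[OF \<open>P \<le> s\<close>]])
      from vector_derivative_diff_chain_within[OF x'[OF \<open>P \<le> s\<close>] has_derivative_at_withinI[OF this]]
      have "((\<lambda>q. f (xbar q \<alpha>)) has_vector_derivative ?A *v f (xbar s \<alpha>)) (at s within {P..})"
        by (simp add: o_def)
      from has_vector_derivative_cross3[OF this xa_var[OF \<open>P \<le> s\<close>]]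
      show ?thesis
        unfolding normal_vec_def cross3_trace[symmetric] by (simp only: add.commute)
    qed
    have "((\<lambda>q. integral {p..q} ?div) has_real_derivative ?div s) (at s within {p..s + 1})"
      using that p
      by (intro integral_has_real_derivative continuous_on_subset[OF cont_div]) auto
    moreover have "at s within {p..s + 1} = at s within {p..}"
      by (rule at_within_nhd[of _ "{..<s + 1}"]) auto
    ultimately have "((\<lambda>q. integral {p..q} ?div) has_real_derivative ?div s) (at s within {p..})"
      by simp
    then have E': "((\<lambda>q. exp (- integral {p..q} ?div)) has_real_derivative
        exp (- integral {p..s} ?div) * - ?div s) (at s within {p..})"
      by (auto intro!: derivative_eq_intros)
    have "(?N has_vector_derivative trace ?A *\<^sub>R ?N s - transpose ?A *v ?N s) (at s within {p..})"
      using p by (intro has_vector_derivative_within_subset[OF N']) auto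
    from has_vector_derivative_scaleR[OF E' this] show ?thesis
      unfolding w_def[abs_def] A_def x_def by (simp add: divergence_def algebra_simps)
  qed
  obtain \<mu> where \<mu>: "\<mu> > 0" and left_ev: "\<And>n y. (\<And>z. z \<in> stable_subspace (jacobian f (at a)) \<Longrightarrow> n \<bullet> z = 0) \<Longrightarrow>
      n \<bullet> (jacobian f (at a) *v y) = \<mu> * (n \<bullet> y)"
    using saddle_left_eigenvector[OF spectrum] by blast
  txt \<open>Both \<open>f\<close> and \<open>x\<^sub>\<alpha>\<close> are tangent to the surface, so \<open>f \<times> x\<^sub>\<alpha>\<close> is parallel to the normal \<open>n\<close> computed in the
    chart, which is continuous up to \<open>a\<close>.\<close>
  obtain n n0 where n: "(n \<longlongrightarrow> n0) at_top" "n0 \<noteq> 0"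
    and n0: "\<And>z. z \<in> stable_subspace (jacobian f (at a)) \<Longrightarrow> n0 \<bullet> z = 0"
    and n_par: "\<And>s. \<lbrakk>s \<ge> P; n s \<noteq> 0\<rbrakk> \<Longrightarrow> \<exists>c. normal_vec f xbar s \<alpha> = c *\<^sub>R n s"
  proof -
    from manifold_C2 have V: "open V" "0 \<in> V" "inj_on \<Phi> V" and \<Phi>_C2: "C2_on \<Phi> V"
      and inj: "\<And>v. v \<in> V \<Longrightarrow> inj (frechet_derivative \<Phi> (at v))"
      and surj: "\<Phi> ` V = stable_manifold_fp f \<Omega> a"
      and tangent: "range (frechet_derivative \<Phi> (at 0)) = stable_subspace (jacobian f (at a))"
      unfolding C2_stable_manifold_chart_def by blast+
    from \<Phi>_C2 V(1) obtain \<Phi>' where \<Phi>': "\<And>v. v \<in> V \<Longrightarrow> (\<Phi> has_derivative blinfun_apply (\<Phi>' v)) (at v)"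
      and \<Phi>'_C1: "C1_on \<Phi>' V"
      unfolding C2_on_def by (metis at_within_open)
    from \<Phi>'_C1 V(1,2) have "\<Phi>' differentiable (at 0)"
      unfolding C1_on_def differentiable_def by (metis at_within_open)
    then have cont_\<Phi>': "isCont \<Phi>' 0" by (rule differentiable_imp_continuous_within)
    have fd: "frechet_derivative \<Phi> (at v) = blinfun_apply (\<Phi>' v)" if "v \<in> V" for v
      using frechet_derivative_at[OF \<Phi>'[OF that]] by simp
    define v where "v s \<beta> = the_inv_into V \<Phi> (xbar s \<beta>)" for s \<beta>
    define nrm where "nrm L = cross3 (blinfun_apply L (axis 1 1)) (blinfun_apply L (axis 2 1))"
      for L :: "(real^2) \<Rightarrow>\<^sub>L (real^3)"
    have lin: "linear (blinfun_apply L)" for L :: "(real^2) \<Rightarrow>\<^sub>L (real^3)"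
      by (simp add: blinfun.bounded_linear_right bounded_linear.linear)
    have v_mem: "v s \<beta> \<in> V \<and> \<Phi> (v s \<beta>) = xbar s \<beta>" if "s \<ge> P" for s \<beta>
    proof -
      have shift_sol: "solves_on (\<lambda>x t. f x) \<Omega> (\<lambda>\<tau>. xbar (s + \<tau>) \<beta>) {0..}"
        unfolding solves_on_def
      proof (intro ballI conjI)
        fix \<tau> :: real assume \<tau>: "\<tau> \<in> {0..}"
        then show "xbar (s + \<tau>) \<beta> \<in> \<Omega>" using sol[of \<beta>] that by (simp add: solves_on_def)
        have "((\<lambda>q. xbar q \<beta>) has_vector_derivative f (xbar (s + \<tau>) \<beta>)) (at (s + \<tau>) within (\<lambda>\<tau>. s + \<tau>) ` {0..})"
        proof (rule has_vector_derivative_within_subset)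
          show "((\<lambda>q. xbar q \<beta>) has_vector_derivative f (xbar (s + \<tau>) \<beta>)) (at (s + \<tau>) within {P..})"
            using sol[of \<beta>] that \<tau> by (simp add: solves_on_def)
          show "(\<lambda>\<tau>. s + \<tau>) ` {0..} \<subseteq> {P..}" using that by auto
        qed
        moreover have "((\<lambda>\<tau>. s + \<tau>) has_vector_derivative 1) (at \<tau> within {0..})"
          by (auto intro!: derivative_eq_intros simp flip: has_real_derivative_iff_has_vector_derivative)
        ultimately show "((\<lambda>\<tau>. xbar (s + \<tau>) \<beta>) has_vector_derivative f (xbar (s + \<tau>) \<beta>)) (at \<tau> within {0..})"
          using vector_diff_chain_within[of "\<lambda>\<tau>. s + \<tau>" 1 \<tau> "{0..}" "\<lambda>q. xbar q \<beta>"] by (simp add: o_def)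
      qed
      have "filterlim (\<lambda>\<tau>. s + \<tau>) at_top at_top"
        by (rule filterlim_tendsto_add_at_top[OF tendsto_const filterlim_ident])
      from filterlim_compose[OF lim_xbar[of \<beta>] this]
      have "((\<lambda>\<tau>. xbar (s + \<tau>) \<beta> - a) \<longlongrightarrow> 0) at_top"
        by (rule LIM_zero)
      with shift_sol have "\<exists>y. solves_on (\<lambda>x t. f x) \<Omega> y {0..} \<and> y 0 = xbar s \<beta> \<and> ((\<lambda>\<tau>. y \<tau> - a) \<longlongrightarrow> 0) at_top"
        by (intro exI[of _ "\<lambda>\<tau>. xbar (s + \<tau>) \<beta>"]) simp
      then have "xbar s \<beta> \<in> \<Phi> ` V"
        by (simp add: surj stable_manifold_fp_def stable_manifold_def)
      then show ?thesis
        using V(3) by (simp add: v_def the_inv_into_into f_the_inv_into_f)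
    qed
    have orth: "nrm L \<bullet> blinfun_apply L h = 0" for L h
      unfolding nrm_def by (rule plane_normal(1)[OF lin])
    show thesis
    proof (rule that)
      show "((\<lambda>s. nrm (\<Phi>' (v s \<alpha>))) \<longlongrightarrow> nrm (\<Phi>' 0)) at_top"
        unfolding nrm_def
        by (intro bounded_bilinear.tendsto[OF bounded_bilinear_cross3] blinfun.tendsto tendsto_const
            isCont_tendsto_compose[OF cont_\<Phi>'] lim_v[folded v_def])
      show "nrm (\<Phi>' 0) \<noteq> 0"
        unfolding nrm_def using inj[OF V(2)] by (intro plane_normal(2) lin) (simp add: fd V(2))
      show "nrm (\<Phi>' 0) \<bullet> z = 0" if "z \<in> stable_subspace (jacobian f (at a))" for z
        using that orth by (auto simp: fd V(2) simp flip: tangent)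
      fix s assume s: "s \<ge> P" and ne: "nrm (\<Phi>' (v s \<alpha>)) \<noteq> 0"
      have vs: "v s \<alpha> \<in> V" using v_mem[OF s] by simp
      have inj': "inj (blinfun_apply (\<Phi>' (v s \<alpha>)))" using inj[OF vs] by (simp add: fd vs)
      have "nrm (\<Phi>' (v s \<alpha>)) \<bullet> f (xbar s \<alpha>) = 0"
      proof (rule derivative_normal_to_range[where \<gamma> = "\<lambda>q. v q \<alpha>" and I = "{P..}", OF \<Phi>'[OF vs] inj'])
        have "continuous_on {P..} (\<lambda>q. (\<lambda>(p, \<alpha>). the_inv_into V \<Phi> (xbar p \<alpha>)) (q, \<alpha>))"
          by (rule continuous_on_compose2[OF cont_v]) (auto intro!: continuous_intros)
        then show "continuous (at s within {P..}) (\<lambda>q. v q \<alpha>)"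
          using s by (simp add: continuous_on_eq_continuous_within v_def)
        have "((\<lambda>q. xbar q \<alpha>) has_vector_derivative f (xbar s \<alpha>)) (at s within {P..})"
          using sol[of \<alpha>] s by (simp add: solves_on_def)
        then show "((\<Phi> \<circ> (\<lambda>q. v q \<alpha>)) has_vector_derivative f (xbar s \<alpha>)) (at s within {P..})"
          by (rule has_vector_derivative_transform[rotated 2]) (use s v_mem in auto)
        show "at s within {P..} \<noteq> bot"
        proof -
          have "{s<..} \<subseteq> {P..}" using s by auto
          from at_le[OF this, of s] show ?thesis
            using trivial_limit_at_right_real[of s] by (auto simp: bot_unique)
        qed
      qed (rule orth)
      moreover have "nrm (\<Phi>' (v s \<alpha>)) \<bullet> xbar_alpha xbar s \<alpha> = 0"
      proof (rule derivative_normal_to_range[where \<gamma> = "\<lambda>\<beta>. v s \<beta>" and I = UNIV, OF \<Phi>'[OF vs] inj'])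
        have "continuous_on UNIV (\<lambda>\<beta>. (\<lambda>(p, \<alpha>). the_inv_into V \<Phi> (xbar p \<alpha>)) (s, \<beta>))"
          using s by (intro continuous_on_compose2[OF cont_v]) (auto intro!: continuous_intros)
        then show "continuous (at \<alpha>) (\<lambda>\<beta>. v s \<beta>)"
          by (simp add: continuous_on_eq_continuous_within v_def)
        have "(\<Phi> \<circ> (\<lambda>\<beta>. v s \<beta>)) = (\<lambda>\<beta>. xbar s \<beta>)" using v_mem[OF s] by auto
        then show "((\<Phi> \<circ> (\<lambda>\<beta>. v s \<beta>)) has_vector_derivative xbar_alpha xbar s \<alpha>) (at \<alpha>)"
          using xa_deriv[OF s] by simp
      qed (auto simp: orth)
      ultimately show "\<exists>c. normal_vec f xbar s \<alpha> = c *\<^sub>R nrm (\<Phi>' (v s \<alpha>))"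
        unfolding normal_vec_def using cross3_parallel[OF ne] by blast
    qed
  qed
  have "isCont (\<lambda>x. jacobian f (at x)) a"
    using C2_on_continuous_jacobian[OF f_C2 Omega] Omega fixed_point(1)
    by (simp add: continuous_on_eq_continuous_at)
  then have A_lim: "(A \<longlongrightarrow> jacobian f (at a)) at_top"
    unfolding A_def by (rule isCont_tendsto_compose[OF _ x_lim])
  have w_par: "\<exists>c. w s = c *\<^sub>R n s" if s: "s \<ge> p" and ns: "n s \<noteq> 0" for s
  proof -
    have "P \<le> s" using p s by simp
    then obtain c where "normal_vec f xbar s \<alpha> = c *\<^sub>R n s"
      using n_par ns by blast
    then have "w s = (exp (- integral {p..s} (\<lambda>\<xi>. divergence f (xbar \<xi> \<alpha>))) * c) *\<^sub>R n s"
      by (simp add: w_def)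
    then show ?thesis ..
  qed
  obtain D \<kappa> where D: "D \<ge> 0" "\<kappa> > 0" and decay: "\<And>s. s \<ge> p \<Longrightarrow> norm (w s) \<le> D * exp (- \<kappa> * (s - p))"
    using adjoint_solution_decay[OF w' A_lim n left_ev[OF n0] \<mu> w_par] by metis
  obtain S where S: "compact S" "S \<subseteq> \<Omega>" "x ` {p..} \<subseteq> S"
    using trajectory_in_compact[OF continuous_on_vector_derivative_Ici[OF x' order_refl] x_lim Omega fixed_point(1)] x_in
    by auto
  obtain r C where r: "r > 0" and C: "C \<ge> 0" and ball: "\<And>z. z \<in> S \<Longrightarrow> cball z r \<subseteq> \<Omega>"
    and taylor: "\<And>z y. \<lbrakk>z \<in> S; norm (y - z) \<le> r\<rbrakk> \<Longrightarrow>
      norm (f y - f z - jacobian f (at z) *v (y - z)) \<le> C * (norm (y - z))\<^sup>2"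
    using C2_on_uniform_taylor[OF f_C2 Omega S(1,2)] by metis
  obtain B where B: "\<And>z \<tau>. z \<in> \<Omega> \<Longrightarrow> norm (g z \<tau>) \<le> B"
    using g_bounded unfolding bounded_iff by auto
  obtain G where G: "\<And>z \<tau>. z \<in> \<Omega> \<Longrightarrow> norm (jacobian (\<lambda>z. g z \<tau>) (at z)) \<le> G"
    using Dg_bounded unfolding bounded_iff by auto
  have "G \<ge> 0" using G[OF fixed_point(1)] norm_ge_zero order_trans by blast
  obtain \<epsilon>0 K where "\<epsilon>0 > 0" and pert: "\<And>\<epsilon>. \<epsilon> \<in> {0..\<epsilon>0} \<Longrightarrow> \<exists>y. y t = xs p \<alpha> \<epsilon> t \<and>
      solves_on (\<lambda>x t. f x + \<epsilon> *\<^sub>R g x t) \<Omega> y {t..} \<and> (\<forall>\<tau>\<ge>t. norm (y \<tau> - x (\<tau> - t + p)) \<le> K * \<epsilon>)"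
    using perturbed[OF p \<alpha> t] unfolding x_def by meson
  define \<epsilon>1 where "\<epsilon>1 = min \<epsilon>0 (r / (\<bar>K\<bar> + 1))"
  have \<epsilon>1: "\<epsilon>1 > 0" using \<open>\<epsilon>0 > 0\<close> r by (simp add: \<epsilon>1_def add_nonneg_pos)
  let ?C = "C * K\<^sup>2 + 3 * G * K"
  let ?d = "\<lambda>\<epsilon>. xs p \<alpha> \<epsilon> t - x p"
  have u: "\<exists>u \<rho>. u p = ?d \<epsilon> \<and> (\<forall>s\<ge>p. norm (u s) \<le> K * \<epsilon> \<and> norm (\<rho> s) \<le> ?C * \<epsilon>\<^sup>2 \<and>
      (u has_vector_derivative A s *v u s + \<epsilon> *\<^sub>R h s + \<rho> s) (at s within {p..}))"
    if \<epsilon>: "0 < \<epsilon>" "\<epsilon> \<le> \<epsilon>1" for \<epsilon>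
  proof -
    obtain y where y: "y t = xs p \<alpha> \<epsilon> t" "solves_on (\<lambda>x t. f x + \<epsilon> *\<^sub>R g x t) \<Omega> y {t..}"
      and near: "\<And>\<tau>. \<tau> \<ge> t \<Longrightarrow> norm (y \<tau> - x (\<tau> - t + p)) \<le> K * \<epsilon>"
      using pert[of \<epsilon>] \<epsilon> by (auto simp: \<epsilon>1_def)
    define Y where "Y s = y (s + (t - p))" for s
    define u where "u s = Y s - x s" for s
    define \<rho> where "\<rho> s = (f (Y s) - f (x s) - A s *v u s) + \<epsilon> *\<^sub>R (g (Y s) (s + t - p) - h s)" for s
    have "K * \<epsilon> \<le> (\<bar>K\<bar> + 1) * (r / (\<bar>K\<bar> + 1))"
      using \<epsilon> r by (intro mult_mono) (auto simp: \<epsilon>1_def)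
    also have "\<dots> = r" using abs_ge_zero[of K] by (simp add: field_simps)
    finally have K_r: "K * \<epsilon> \<le> r" .
    show ?thesis
    proof (rule exI[of _ u], rule exI[of _ \<rho>], intro conjI allI impI)
      show "u p = ?d \<epsilon>" by (simp add: u_def Y_def y(1))
      fix s assume s: "p \<le> s"
      show u_le: "norm (u s) \<le> K * \<epsilon>"
        using near[of "s + (t - p)"] s by (simp add: u_def Y_def)
      have xS: "x s \<in> S" using S(3) s by auto
      have "norm (f (Y s) - f (x s) - A s *v u s) \<le> C * (norm (u s))\<^sup>2"
        using taylor[OF xS, of "Y s"] u_le K_r by (simp add: u_def A_def)
      also have "\<dots> \<le> C * (K * \<epsilon>)\<^sup>2"
        using u_le C by (intro mult_left_mono power_mono) auto
      finally have f_rem: "norm (f (Y s) - f (x s) - A s *v u s) \<le> C * (K * \<epsilon>)\<^sup>2" .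
      have "norm (g (Y s) (s + t - p) - h s) \<le> CARD(3) * G * norm (Y s - x s)"
        unfolding h_def using u_le K_r r
        by (intro C2_on_lipschitz_of_jacobian_bound[OF g_C2 Omega convex_cball ball[OF xS] G])
          (auto simp: u_def dist_norm norm_minus_commute)
      also have "\<dots> \<le> 3 * G * (K * \<epsilon>)"
        using u_le \<open>G \<ge> 0\<close> by (simp add: u_def mult_left_mono)
      finally have "\<epsilon> * norm (g (Y s) (s + t - p) - h s) \<le> \<epsilon> * (3 * G * (K * \<epsilon>))"
        using \<epsilon>(1) by (intro mult_left_mono) auto
      then have g_rem: "norm (\<epsilon> *\<^sub>R (g (Y s) (s + t - p) - h s)) \<le> \<epsilon> * (3 * G * (K * \<epsilon>))"
        using \<epsilon>(1) by simp
      have "norm (\<rho> s) \<le> C * (K * \<epsilon>)\<^sup>2 + \<epsilon> * (3 * G * (K * \<epsilon>))"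
        unfolding \<rho>_def by (rule norm_triangle_le[OF add_mono[OF f_rem g_rem]])
      also have "\<dots> = ?C * \<epsilon>\<^sup>2" by (simp add: power2_eq_square algebra_simps)
      finally show "norm (\<rho> s) \<le> ?C * \<epsilon>\<^sup>2" .
      have "(y has_vector_derivative f (Y s) + \<epsilon> *\<^sub>R g (Y s) (s + t - p)) (at (s + (t - p)) within {t..})"
        using y(2) s by (auto simp: solves_on_def Y_def algebra_simps)
      then have "(y has_vector_derivative f (Y s) + \<epsilon> *\<^sub>R g (Y s) (s + t - p))
          (at (s + (t - p)) within (\<lambda>s. s + (t - p)) ` {p..})"
        by (rule has_vector_derivative_within_subset) auto
      moreover have "((\<lambda>s. s + (t - p)) has_vector_derivative 1) (at s within {p..})"
        by (auto intro!: derivative_eq_intros simp flip: has_real_derivative_iff_has_vector_derivative)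
      ultimately have "(Y has_vector_derivative f (Y s) + \<epsilon> *\<^sub>R g (Y s) (s + t - p)) (at s within {p..})"
        using vector_diff_chain_within[of "\<lambda>s. s + (t - p)" 1 s "{p..}" y] by (simp add: o_def Y_def[abs_def])
      from has_vector_derivative_diff[OF this x'[OF s]]
      show "(u has_vector_derivative A s *v u s + \<epsilon> *\<^sub>R h s + \<rho> s) (at s within {p..})"
        by (simp add: u_def[abs_def] \<rho>_def algebra_simps)
    qed
  qed
  have h_le: "norm (h s) \<le> B" if "s \<ge> p" for s
    unfolding h_def using x_in[OF that] by (rule B)
  have integrand: "(\<lambda>s. w s \<bullet> h s) = melnikov_integrand f g xbar p \<alpha> t"
    by (simp add: fun_eq_iff w_def h_def x_def melnikov_integrand_def)
  note expansion = adjoint_pairing_expansion[OF w' decay D(2,1) h_le u \<epsilon>1, unfolded integrand]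
  let ?N = "normal_vec f xbar p \<alpha>"
  let ?R = "\<lambda>\<epsilon>. normal_displacement f xbar xs p \<alpha> \<epsilon> t - \<epsilon> * (melnikov f g xbar p \<alpha> t / norm ?N)"
  have "norm (?R \<epsilon>) \<le> D * ?C / \<kappa> / norm ?N * norm (\<epsilon>\<^sup>2)" if \<epsilon>: "0 < \<epsilon>" "\<epsilon> \<le> \<epsilon>1" for \<epsilon>
  proof -
    have "?R \<epsilon> = (w p \<bullet> ?d \<epsilon> + \<epsilon> * integral {p..} (melnikov_integrand f g xbar p \<alpha> t)) / norm ?N"
      by (simp add: normal_displacement_def melnikov_def w_def x_def divide_inverse algebra_simps)
    then have "norm (?R \<epsilon>) = \<bar>w p \<bullet> ?d \<epsilon> + \<epsilon> * integral {p..} (melnikov_integrand f g xbar p \<alpha> t)\<bar> / norm ?N"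
      by simp
    also have "\<dots> \<le> D * ?C / \<kappa> * \<epsilon>\<^sup>2 / norm ?N"
      by (intro divide_right_mono expansion(2) \<epsilon> norm_ge_zero)
    finally show ?thesis by simp
  qed
  moreover have "\<forall>\<^sub>F \<epsilon> in at_right 0. 0 < \<epsilon> \<and> \<epsilon> \<le> \<epsilon>1"
    using eventually_at_right_less[of "0::real"] eventually_at_right_real[OF \<epsilon>1] by eventually_elim auto
  ultimately have "?R \<in> O[at_right 0](\<lambda>\<epsilon>. \<epsilon>\<^sup>2)"
    by (intro bigoI[where c = "D * ?C / \<kappa> / norm ?N"]) (auto elim: eventually_mono)
  with expansion(1) show "melnikov_integrand f g xbar p \<alpha> t integrable_on {p..} \<and> ?R \<in> O[at_right 0](\<lambda>\<epsilon>. \<epsilon>\<^sup>2)"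
    by blast
qed

end
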